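(* Let $w\in L^1(\mathbb{R}^d)\cap L^\infty(\mathbb{R}^d)$, $w\ne0$, satisfy: for any $a>0$ there exists $c_a>0$ such that $w(\xi)\le c_ae^{-a|\xi|}$ for almost all $\xi\in\mathbb{R}^d$. Assume there exists a measurable function $Q:[0,\infty)\to\mathbb{R}$ such that $w(\xi)=e^{-Q(|\xi|)}$ and such that for all $L>0$ there exists $B>0$ such that for any sufficiently large $t>0$, $$\int_0^{\pi/2}Q_L^{\rm o}(t\cos\theta)\,d\theta<B+\log t.$$ Then: (B) there exists $B>0$ such that for any $y\in\mathbb{R}^d$, $\limsup_{n\to\infty}\mathcal{E}_n^-(y;w)<B$ and $\limsup_{n\to\infty}\mathcal{E}_n^+(y;w)<B$; (C) $\mathcal{G}(w)$ spans ${\rm M}_d(\mathbb{R})$ as a real vector space.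
   Context: For $L\in\mathbb{R}$ and measurable $Q:[0,\infty)\to\mathbb{R}$, put $Q_L(t):=Q(t)-Lt$. For measurable $Q$ define $Q^{\rm m}(t):=\inf\{T\in\mathbb{R}:|\{s\ge t:T\ge Q(s)\}|>0\}$, where $|\cdot|$ of a set is Lebesgue measure, and $Q^{\rm o}:=Q-Q^{\rm m}$. Write $Q_L^{\rm m}:=(Q_L)^{\rm m}$ and $Q_L^{\rm o}:=(Q_L)^{\rm o}$. $L^2(w)$ is the $L^2$-space for the measure $w(\xi)\,d\xi$. $P_n\subset\mathbb{C}[\xi_1,\dots,\xi_d]$ is the space of polynomials of total degree at most $n$, regarded as a subspace of $L^2(w)$. For $y\in\mathbb{R}^d$, $(m_yh)(\xi)=e^{y^\top\xi}h(\xi)$. Define $$\mathcal{E}_n^+(y;w)=\Big(\sup_{P\in P_n\setminus\{0\}}\frac{\|m_yP\|_{L^2(w)}}{\|P\|_{L^2(w)}}\Big)^{1/n},\qquad \mathcal{E}_n^-(y;w)=\Big(\sup_{P\in P_n\setminus\{0\}}\frac{\|P\|_{L^2(w)}}{\|m_yP\|_{L^2(w)}}\Big)^{1/n}.$$ $\mathcal{G}(w)$ is the set of $A\in{\rm GL}_d(\mathbb{R})$ such that for some $\lambda>0$, $w(A^\top\xi)\ge\lambda w(\xi)$ for almost every $\xi\in\mathbb{R}^d$. *)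

theory Defs
  imports "HOL-Analysis.Analysis"
begin

definition QL :: "real \<Rightarrow> (real \<Rightarrow> real) \<Rightarrow> real \<Rightarrow> real" where
  "QL L Q t = Q t - L * t"

text \<open>
  Functions on \<open>[0,\<infinity>)\<close> are encoded as functions on the reals; for \<open>t \<ge> 0\<close> only their values on
  \<open>[0,\<infinity>)\<close> enter below. The infimum is taken in the extended reals, so that it equals
  \<open>-\<infinity>\<close> if \<open>Q\<close> is not essentially bounded below on \<open>[t,\<infinity>)\<close>.
\<close>

definition Qm :: "(real \<Rightarrow> real) \<Rightarrow> real \<Rightarrow> ereal" where
  "Qm Q t = Inf (ereal ` {T. emeasure lebesgue {s. s \<ge> t \<and> T \<ge> Q s} > 0})"

text \<open>
  For measurable \<open>Q\<close>, \<open>Qo Q t \<ge> 0\<close> for almost every \<open>t \<ge> 0\<close>, so its integrals may be taken as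
  nonnegative ones after applying \<^const>\<open>e2ennreal\<close>, which truncates only on a null set.
\<close>

definition Qo :: "(real \<Rightarrow> real) \<Rightarrow> real \<Rightarrow> ereal" where
  "Qo Q t = ereal (Q t) - Qm Q t"

text \<open>The \<open>n\<close>-th root on \<open>[0,\<infinity>]\<close>, for \<open>n \<ge> 1\<close>.\<close>

definition ennreal_root :: "nat \<Rightarrow> ennreal \<Rightarrow> ennreal" where
  "ennreal_root n x = (if x = \<infinity> then \<infinity> else ennreal (root n (enn2real x)))"

definition L2norm :: "(real^'d \<Rightarrow> real) \<Rightarrow> (real^'d \<Rightarrow> complex) \<Rightarrow> ennreal" where
  "L2norm w h =
     ennreal_root 2 (\<integral>\<^sup>+ \<xi>. ennreal ((cmod (h \<xi>))\<^sup>2) \<partial>density lebesgue (\<lambda>\<xi>. ennreal (w \<xi>)))"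

text \<open>
  Polynomials over the infinite field of complex numbers are identified with the functions they
  induce on real Euclidean space; \<open>\<alpha>\<close> ranges over the multi-indices of total degree at most \<open>n\<close>.
\<close>

definition polys :: "nat \<Rightarrow> (real^'d \<Rightarrow> complex) set" where
  "polys n = {P. \<exists>c :: ('d \<Rightarrow> nat) \<Rightarrow> complex.
     P = (\<lambda>\<xi>. \<Sum>\<alpha> | (\<Sum>i\<in>UNIV. \<alpha> i) \<le> n. c \<alpha> * (\<Prod>i\<in>UNIV. complex_of_real (\<xi> $ i) ^ \<alpha> i))}"

lemma finite_multi_indices: "finite {\<alpha> :: 'd::finite \<Rightarrow> nat. (\<Sum>i\<in>UNIV. \<alpha> i) \<le> n}"
proof (rule finite_subset)
  have "\<alpha> i \<le> n" if "(\<Sum>i\<in>UNIV. \<alpha> i) \<le> n" for \<alpha> :: "'d \<Rightarrow> nat" and i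
    using member_le_sum[of i UNIV \<alpha>] that by simp
  then show "{\<alpha> :: 'd \<Rightarrow> nat. (\<Sum>i\<in>UNIV. \<alpha> i) \<le> n} \<subseteq> (\<Pi>\<^sub>E i\<in>UNIV. {..n})"
    by (simp add: subset_iff PiE_UNIV_domain)
qed (intro finite_PiE finite_atMost finite)

definition mexp :: "real^'d \<Rightarrow> (real^'d \<Rightarrow> complex) \<Rightarrow> real^'d \<Rightarrow> complex" where
  "mexp y h \<xi> = complex_of_real (exp (y \<bullet> \<xi>)) * h \<xi>"

definition E_plus :: "nat \<Rightarrow> real^'d \<Rightarrow> (real^'d \<Rightarrow> real) \<Rightarrow> ennreal" where
  "E_plus n y w =
     ennreal_root n (SUP P\<in>polys n - {\<lambda>_. 0}. L2norm w (mexp y P) / L2norm w P)"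

definition E_minus :: "nat \<Rightarrow> real^'d \<Rightarrow> (real^'d \<Rightarrow> real) \<Rightarrow> ennreal" where
  "E_minus n y w =
     ennreal_root n (SUP P\<in>polys n - {\<lambda>_. 0}. L2norm w P / L2norm w (mexp y P))"

definition calG :: "(real^'d \<Rightarrow> real) \<Rightarrow> (real^'d^'d) set" where
  "calG w = {A. invertible A \<and>
     (\<exists>r>0. AE \<xi> in lebesgue. w (transpose A *v \<xi>) \<ge> r * w \<xi>)}"

end

theory Submission
  imports Defs "HOL-Computational_Algebra.Fundamental_Theorem_Algebra" "HOL-Real_Asymp.Real_Asymp"
begin

text \<open>
  That the matrices in \<^term>\<open>calG w\<close> span the matrix space is due to the radial symmetry of the
  weight: they include all orthogonal matrices, and already the signed permutation matrices span.

  For the bounds on \<^term>\<open>E_plus n y w\<close> and \<^term>\<open>E_minus n y w\<close>, put \<open>K = 2 \<bar>y\<bar>\<close>. Since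
  \<open>\<bar>2 y \<bullet> \<xi>\<bar> \<le> K \<bar>\<xi>\<bar>\<close>, both follow from one inequality between radial weights,
  \<open>\<integral> \<bar>P\<bar>\<^sup>2 exp (- Q(\<bar>\<xi>\<bar>) + K \<bar>\<xi>\<bar>) d\<xi> \<le> R\<^bsup>2n\<^esup> \<integral> \<bar>P\<bar>\<^sup>2 exp (- Q(\<bar>\<xi>\<bar>) - K \<bar>\<xi>\<bar>) d\<xi>\<close>
  for all \<open>P\<close> of degree at most \<open>n\<close>, once \<open>n\<close> is large, with an absolute constant \<open>R\<close> (lemma
  \<open>eventually_weighted_inequality\<close>). By polar coordinates (\<open>nn_integral_le_if_ray_integral_le\<close>)
  it suffices to prove this along each ray, where \<open>P\<close> becomes a polynomial \<open>p\<close> in one variable \<open>r\<close>.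

  Cut the ray at \<open>T = n/(4 K + 1)\<close>. On \<open>[0,T]\<close> the two weights differ by a factor of at most
  \<open>exp n\<close>. Beyond \<open>T\<close>, write \<open>Q(r) = Q\<^sub>L(r) + L r\<close> with \<open>L = 3 K + 1\<close>, and let \<open>M\<close> be the essential
  infimum of \<open>Q\<^sub>L\<close> on \<open>[T,\<infinity>)\<close>. There the left-hand weight is at most \<open>exp (- M - (L - K) r)\<close>, and the
  linear term is strong enough to beat the growth of \<open>\<bar>p\<bar>\<^sup>2\<close>: factoring \<open>p\<close> shows
  \<open>\<bar>p(r)\<bar> \<le> (C (r/T + 1))\<^sup>n exp l\<close>, where \<open>l\<close> is an average of \<open>ln \<bar>p\<bar>\<close> over \<open>[0,T]\<close>
  (\<open>log_minorized_degree\<close>). So the tail is at most \<open>C\<^sup>n exp (2 l - M)\<close>, up to powers of \<open>T\<close> that cancel.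
  Conversely, on \<open>[0,T]\<close> the excess of \<open>Q\<^sub>L\<close> over \<open>M\<close> is at most its oscillation, because the lower
  envelope of \<open>Q\<^sub>L\<close> is increasing; and the hypothesis bounds the average of the oscillation by
  \<open>B + ln T\<close> (\<open>oscillation_bound\<close>). Hence on a large part of \<open>[0,T]\<close> the right-hand integrand is at
  least \<open>exp (2 l - M)\<close> up to a factor exponential in \<open>n\<close> and a power of \<open>T\<close>, and the tail is
  dominated (\<open>half_line_inequality\<close>). Since factors exponential in \<open>n\<close>
  are harmless throughout, crude estimates for the logarithmic averages are enough.
\<close>

section \<open>Logarithmic averages and growth of polynomials\<close>

text \<open>
  The logarithmic singularity of a linear factor is dominated by an inverse square root, which is
  integrable with a bound that does not see the position of the zero.
\<close>

lemma nn_integral_inverse_sqrt_le: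
  "(\<integral>\<^sup>+x\<in>{0..1}. ennreal (\<bar>x - a\<bar> powr (-1/2)) \<partial>lborel) \<le> 5"
proof -
  define f :: "real \<Rightarrow> ennreal" where "f = (\<lambda>u. ennreal (u powr (-1/2)) * indicator {0..1} u)"
  have [measurable]: "f \<in> borel_measurable borel" unfolding f_def by measurable
  have "((\<lambda>x. x powr (-1/2)) has_integral (1 powr (-1/2 + 1) / (-1/2 + 1))) {0..1::real}"
    by (rule has_integral_powr_from_0) auto
  then have "((\<lambda>x. x powr (-1/2)) has_integral 2) {0..1::real}" by simp
  from nn_integral_has_integral_lebesgue'[OF _ this]
  have f2: "(\<integral>\<^sup>+x. f x \<partial>lborel) = 2" unfolding f_def by simp
  have shift: "(\<integral>\<^sup>+x. f (- a + 1 * x) \<partial>lborel) = 2" "(\<integral>\<^sup>+x. f (a + (-1) * x) \<partial>lborel) = 2"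
    using nn_integral_real_affine[of f 1 "- a"] nn_integral_real_affine[of f "-1" a] f2 by auto
  have "(\<integral>\<^sup>+x\<in>{0..1}. ennreal (\<bar>x - a\<bar> powr (-1/2)) \<partial>lborel)
      \<le> (\<integral>\<^sup>+x. (f (- a + 1 * x) + f (a + (-1) * x)) + indicator {0..1} x \<partial>lborel)"
  proof (rule nn_integral_mono)
    fix x :: real
    show "ennreal (\<bar>x - a\<bar> powr (-1/2)) * indicator {0..1} x
        \<le> f (- a + 1 * x) + f (a + (-1) * x) + indicator {0..1} x"
    proof (cases "\<bar>x - a\<bar> \<le> 1")
      case True
      then show ?thesis
        by (cases "x \<ge> a") (auto simp: f_def indicator_def abs_if intro!: add_increasing2)
    next
      case False
      then have "\<bar>x - a\<bar> powr (-1/2) \<le> 1 powr (-1/2)"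
        by (intro powr_mono2') auto
      then show ?thesis
        by (auto simp: indicator_def intro!: add_increasing)
    qed
  qed
  also have "\<dots> = 2 + 2 + 1"
    using shift by (subst nn_integral_add, simp, simp)+ simp
  finally show ?thesis by simp
qed

text \<open>
  With \<open>v = 1/\<surd>u\<close> this is \<open>ln v \<le> v\<close>.
\<close>

lemma exp_inverse_sqrt_le:
  fixes u :: real
  assumes "u > 0"
  shows "exp (- (2 * u powr (-1/2))) \<le> u"
proof -
  have "ln (u powr (-1/2)) \<le> u powr (-1/2) - 1"
    using assms by (intro ln_le_minus_one) simp
  then have "- (2 * u powr (-1/2)) \<le> ln u"
    using assms by (simp add: ln_powr)
  then show ?thesis
    using assms by (simp add: ln_ge_iff)
qed

text \<open>
  A quantitative form of the fact that the average of \<open>ln \<bar>p\<bar>\<close> over \<open>[0,1]\<close> controls the growth of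
  \<open>p\<close> on the half-line: \<open>lam\<close> plays the role of that average, up to an error of order \<open>n\<close>. Using a
  minorant of \<open>ln \<bar>p\<bar>\<close> in place of \<open>ln \<bar>p\<bar>\<close> itself makes the notion multiplicative in \<open>p\<close>
  without any care for the zeros.
\<close>

definition log_minorized :: "nat \<Rightarrow> complex poly \<Rightarrow> bool" where
  "log_minorized n p \<longleftrightarrow> (\<exists>lam k. k \<in> borel_measurable borel \<and> (\<forall>x. 0 \<le> k x) \<and>
     (\<integral>\<^sup>+x\<in>{0..1}. ennreal (k x) \<partial>lborel) \<le> ennreal (10 * real n) \<and>
     (AE x in lborel. x \<in> {0..1} \<longrightarrow> exp (lam - k x) \<le> cmod (poly p (of_real x))) \<and>
     (\<forall>x\<ge>0. cmod (poly p (of_real x)) \<le> (2 * (x + 1)) ^ n * exp lam))"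

text \<open>
  A factor with a distant zero is essentially constant on \<open>[0,1]\<close>. For a zero \<open>z\<close> with \<open>\<bar>z\<bar> < 2\<close>, the
  distance to \<open>z\<close> is at least the distance to its real part, whose logarithm has a singularity
  that the inverse square root absorbs.
\<close>

lemma log_minorized_linear: "log_minorized 1 [:- z, 1:]"
proof (cases "cmod z \<ge> 2")
  case True
  have e: "exp (ln (cmod z / 2)) = cmod z / 2"
    using True by (subst exp_ln) auto
  have "exp (ln (cmod z / 2) - 0) \<le> cmod (poly [:- z, 1:] (of_real x))" if "x \<in> {0..1}" for x :: real
  proof -
    have "cmod z - cmod (of_real x) \<le> cmod (of_real x - z)"
      using norm_triangle_ineq2[of z "of_real x"] by (simp add: norm_minus_commute)
    then show ?thesis using True that e by (simp add: norm_of_real)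
  qed
  moreover have "cmod (poly [:- z, 1:] (of_real x)) \<le> (2 * (x + 1)) ^ 1 * exp (ln (cmod z / 2))"
    if "x \<ge> 0" for x :: real
  proof -
    have "cmod (of_real x - z) \<le> x + cmod z"
      using norm_triangle_ineq4[of "of_real x" z] that by simp
    also have "\<dots> \<le> x * cmod z + cmod z"
      using True that by (simp add: mult_le_cancel_left1)
    finally show ?thesis using True by (simp add: e algebra_simps)
  qed
  ultimately show ?thesis unfolding log_minorized_def
    by (intro exI[of _ "ln (cmod z / 2)"] exI[of _ "\<lambda>_. 0"]) auto
next
  case False
  define k where "k = (\<lambda>x. 2 * \<bar>x - Re z\<bar> powr (-1/2))"
  have "(\<integral>\<^sup>+x\<in>{0..1}. ennreal (k x) \<partial>lborel)
      = (\<integral>\<^sup>+x. 2 * (ennreal (\<bar>x - Re z\<bar> powr (-1/2)) * indicator {0..1} x) \<partial>lborel)"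
    unfolding k_def by (simp add: ennreal_mult mult.assoc)
  also have "\<dots> = 2 * (\<integral>\<^sup>+x\<in>{0..1}. ennreal (\<bar>x - Re z\<bar> powr (-1/2)) \<partial>lborel)"
    by (rule nn_integral_cmult) measurable
  also have "\<dots> \<le> 2 * 5"
    by (intro mult_left_mono nn_integral_inverse_sqrt_le) auto
  finally have "(\<integral>\<^sup>+x\<in>{0..1}. ennreal (k x) \<partial>lborel) \<le> ennreal (10 * real 1)" by simp
  moreover have "AE x in lborel. x \<in> {0..1} \<longrightarrow> exp (0 - k x) \<le> cmod (poly [:- z, 1:] (of_real x))"
    using AE_lborel_singleton[of "Re z"]
  proof eventually_elim
    case (elim x)
    have "exp (0 - k x) \<le> \<bar>x - Re z\<bar>"
      unfolding k_def using exp_inverse_sqrt_le[of "\<bar>x - Re z\<bar>"] elim by simp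
    also have "\<dots> \<le> cmod (of_real x - z)"
      using abs_Re_le_cmod[of "of_real x - z"] by simp
    finally show ?case by simp
  qed
  moreover have "cmod (poly [:- z, 1:] (of_real x)) \<le> (2 * (x + 1)) ^ 1 * exp 0" if "x \<ge> 0" for x :: real
    using norm_triangle_ineq4[of "of_real x" z] that False by simp
  moreover have "k \<in> borel_measurable borel" unfolding k_def by measurable
  ultimately show ?thesis unfolding log_minorized_def
    by (intro exI[of _ 0] exI[of _ k]) (auto simp: k_def)
qed

lemma log_minorized_mult:
  assumes "log_minorized m p" "log_minorized n q"
  shows "log_minorized (m + n) (p * q)"
proof -
  obtain l1 k1 where 1: "k1 \<in> borel_measurable borel" "\<And>x. 0 \<le> k1 x"
     "(\<integral>\<^sup>+x\<in>{0..1}. ennreal (k1 x) \<partial>lborel) \<le> ennreal (10 * real m)"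
     "AE x in lborel. x \<in> {0..1} \<longrightarrow> exp (l1 - k1 x) \<le> cmod (poly p (of_real x))"
     "\<And>x. 0 \<le> x \<Longrightarrow> cmod (poly p (of_real x)) \<le> (2 * (x + 1)) ^ m * exp l1"
    using assms(1) unfolding log_minorized_def by blast
  obtain l2 k2 where 2: "k2 \<in> borel_measurable borel" "\<And>x. 0 \<le> k2 x"
     "(\<integral>\<^sup>+x\<in>{0..1}. ennreal (k2 x) \<partial>lborel) \<le> ennreal (10 * real n)"
     "AE x in lborel. x \<in> {0..1} \<longrightarrow> exp (l2 - k2 x) \<le> cmod (poly q (of_real x))"
     "\<And>x. 0 \<le> x \<Longrightarrow> cmod (poly q (of_real x)) \<le> (2 * (x + 1)) ^ n * exp l2"
    using assms(2) unfolding log_minorized_def by blast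
  note [measurable] = 1(1) 2(1)
  have "(\<integral>\<^sup>+x\<in>{0..1}. ennreal (k1 x + k2 x) \<partial>lborel)
      = (\<integral>\<^sup>+x\<in>{0..1}. ennreal (k1 x) \<partial>lborel) + (\<integral>\<^sup>+x\<in>{0..1}. ennreal (k2 x) \<partial>lborel)"
    using 1(2) 2(2) by (subst nn_integral_add[symmetric]) (auto simp: distrib_right)
  also have "\<dots> \<le> ennreal (10 * real m) + ennreal (10 * real n)"
    by (intro add_mono 1 2)
  also have "\<dots> = ennreal (10 * real (m + n))"
    by (simp flip: ennreal_plus)
  finally have int: "(\<integral>\<^sup>+x\<in>{0..1}. ennreal (k1 x + k2 x) \<partial>lborel) \<le> ennreal (10 * real (m + n))" .
  have low: "AE x in lborel. x \<in> {0..1} \<longrightarrow>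
      exp ((l1 + l2) - (k1 x + k2 x)) \<le> cmod (poly (p * q) (of_real x))"
    using 1(4) 2(4)
  proof eventually_elim
    case (elim x)
    have "exp ((l1 + l2) - (k1 x + k2 x)) = exp (l1 - k1 x) * exp (l2 - k2 x)"
      by (simp flip: exp_add)
    with elim show ?case by (auto simp: norm_mult intro!: mult_mono)
  qed
  have up: "cmod (poly (p * q) (of_real x)) \<le> (2 * (x + 1)) ^ (m + n) * exp (l1 + l2)" if "x \<ge> 0" for x
    using mult_mono[OF 1(5)[OF that] 2(5)[OF that]] that
    by (simp add: norm_mult power_add exp_add mult_ac)
  show ?thesis unfolding log_minorized_def
    using int low up 1(2) 2(2)
    by (intro exI[of _ "l1 + l2"] exI[of _ "\<lambda>x. k1 x + k2 x"]) auto
qed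

text \<open>
  Split off one linear factor after the other by the fundamental theorem of algebra.
\<close>

lemma log_minorized_degree:
  assumes "p \<noteq> 0"
  shows "log_minorized (degree p) p"
  using assms
proof (induction "degree p" arbitrary: p)
  case 0
  from \<open>0 = degree p\<close> obtain c where c: "p = [:c:]"
    by (metis degree_eq_zeroE)
  with \<open>p \<noteq> 0\<close> have "c \<noteq> 0" by simp
  have "degree p = 0" using 0 by simp
  have "log_minorized 0 [:c:]" unfolding log_minorized_def
    using \<open>c \<noteq> 0\<close> by (intro exI[of _ "ln (cmod c)"] exI[of _ "\<lambda>_. 0"]) simp
  then show ?case using c \<open>degree p = 0\<close> by simp
next
  case (Suc n)
  have "\<not> constant (poly p)" using \<open>Suc n = degree p\<close> by (metis constant_degree nat.distinct(1))
  then obtain z where "poly p z = 0" using fundamental_theorem_of_algebra by blast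
  then obtain q where q: "p = [:- z, 1:] * q" unfolding poly_eq_0_iff_dvd dvd_def by blast
  have "q \<noteq> 0" using Suc.prems q by (metis mult_zero_right)
  have "degree p = 1 + degree q" unfolding q
    using \<open>q \<noteq> 0\<close> by (subst degree_mult_eq) auto
  then have "n = degree q" using \<open>Suc n = degree p\<close> by linarith
  then have "log_minorized (degree q) q" by (rule Suc.hyps(1)) fact
  from log_minorized_mult[OF log_minorized_linear[of z] this] show ?case
    unfolding \<open>degree p = 1 + degree q\<close> q[symmetric] .
qed

section \<open>A weighted inequality on the half-line\<close>

lemma log_minorized_mono:
  assumes "log_minorized m p" "m \<le> n"
  shows "log_minorized n p"
proof -
  obtain l k where k: "k \<in> borel_measurable borel" "\<And>x. 0 \<le> k x"
     "(\<integral>\<^sup>+x\<in>{0..1}. ennreal (k x) \<partial>lborel) \<le> ennreal (10 * real m)"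
     "AE x in lborel. x \<in> {0..1} \<longrightarrow> exp (l - k x) \<le> cmod (poly p (of_real x))"
     "\<And>x. 0 \<le> x \<Longrightarrow> cmod (poly p (of_real x)) \<le> (2 * (x + 1)) ^ m * exp l"
    using assms(1) unfolding log_minorized_def by blast
  have "(\<integral>\<^sup>+x\<in>{0..1}. ennreal (k x) \<partial>lborel) \<le> ennreal (10 * real n)"
    using k(3) \<open>m \<le> n\<close> by (elim order_trans) (auto intro!: ennreal_leI)
  moreover have "cmod (poly p (of_real x)) \<le> (2 * (x + 1)) ^ n * exp l" if "0 \<le> x" for x
  proof -
    have "(2 * (x + 1)) ^ m \<le> (2 * (x + 1)) ^ n"
      using that \<open>m \<le> n\<close> by (intro power_increasing) auto
    then show ?thesis using k(5)[OF that] by (meson exp_ge_zero mult_right_mono order_trans)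
  qed
  ultimately show ?thesis unfolding log_minorized_def
    using k by (intro exI[of _ l] exI[of _ k]) auto
qed

text \<open>
  Markov's inequality: a density with integral at most \<open>C\<close> exceeds \<open>4 C\<close> on a set of measure at most
  \<open>1/4\<close>. The interval \<open>[1/2,1]\<close> stays away from the origin, where the radial weight \<open>x\<^sup>m\<close> degenerates.
\<close>

lemma emeasure_sublevel_ge:
  fixes k :: "real \<Rightarrow> real"
  assumes [measurable]: "k \<in> borel_measurable borel" and "C > 0"
    and int: "(\<integral>\<^sup>+x\<in>{0..1}. ennreal (k x) \<partial>lborel) \<le> ennreal C"
  shows "ennreal (1/4) \<le> emeasure lborel {x \<in> {1/2..1}. k x \<le> 4 * C}"
proof -
  let ?E = "{x \<in> {1/2..1}. k x \<le> 4 * C}"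
  let ?N = "{x \<in> {0..1}. 1 \<le> ennreal (1 / (4 * C)) * ennreal (k x)}"
  have "emeasure lborel ?N \<le> ennreal (1 / (4 * C)) * (\<integral>\<^sup>+x\<in>{0..1}. ennreal (k x) \<partial>lborel)"
    by (rule nn_integral_Markov_inequality) measurable
  also have "\<dots> \<le> ennreal (1 / (4 * C)) * ennreal C"
    by (intro mult_left_mono int) auto
  also have "\<dots> = ennreal (1/4)"
    using \<open>C > 0\<close> by (simp flip: ennreal_mult)
  finally have N: "emeasure lborel ?N \<le> ennreal (1/4)" .
  have "{1/2..1::real} \<subseteq> ?E \<union> ?N"
  proof
    fix x :: real assume x: "x \<in> {1/2..1}"
    show "x \<in> ?E \<union> ?N"
    proof (cases "k x \<le> 4 * C")
      case False
      then have "1 \<le> 1 / (4 * C) * k x" using \<open>C > 0\<close> by (simp add: field_simps)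
      then have "ennreal 1 \<le> ennreal (1 / (4 * C) * k x)" by (rule ennreal_leI)
      also have "\<dots> = ennreal (1 / (4 * C)) * ennreal (k x)"
        using \<open>C > 0\<close> False by (intro ennreal_mult) auto
      finally show ?thesis using x by simp
    qed (use x in auto)
  qed
  then have "emeasure lborel {1/2..1::real} \<le> emeasure lborel (?E \<union> ?N)"
    by (rule emeasure_mono) measurable
  also have "\<dots> \<le> emeasure lborel ?E + emeasure lborel ?N"
    by (rule emeasure_subadditive) measurable
  also have "\<dots> \<le> emeasure lborel ?E + ennreal (1/4)"
    by (intro add_left_mono N)
  finally have half: "ennreal (1/2) \<le> emeasure lborel ?E + ennreal (1/4)"
    by (subst (asm) emeasure_lborel_Icc) auto
  show ?thesis
  proof (cases "emeasure lborel ?E")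
    case (real r)
    then have "ennreal (1/2) \<le> ennreal (r + 1/4)"
      using half by (subst ennreal_plus) auto
    then have "1/4 \<le> r" using real by (subst (asm) ennreal_le_iff) auto
    then show ?thesis unfolding real(2) by (rule ennreal_leI)
  qed simp
qed

text \<open>
  The inequality \<open>(1 + y/m)\<^sup>m \<le> exp y\<close> at \<open>y = x/8\<close>; the exponent \<open>x/8\<close> leaves half of the factor
  \<open>exp (- x/4)\<close> over for integration.
\<close>

lemma power_le_exp:
  fixes x :: real
  assumes "x \<ge> 0"
  shows "x ^ m \<le> (8 * real m) ^ m * exp (x / 8)"
proof (cases "m = 0")
  case True
  then show ?thesis using assms by simp
next
  case False
  have "(x / 8 / real m) ^ m \<le> (1 + x / 8 / real m) ^ m"
    using assms False by (intro power_mono) auto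
  also have "\<dots> \<le> exp (x / 8)"
    using assms False by (intro exp_ge_one_plus_x_over_n_power_n) auto
  finally show ?thesis using False by (simp add: power_divide field_simps power_mult_distrib)
qed

lemma nn_integral_power_exp_le:
  "(\<integral>\<^sup>+x\<in>{0..}. ennreal (x ^ m * exp (- x / 4)) \<partial>lborel) \<le> ennreal (8 * (8 * real m) ^ m)"
proof -
  have lim: "((\<lambda>x::real. - 8 * exp (- x / 8)) \<longlongrightarrow> 0) at_top"
    by real_asymp
  have "(\<integral>\<^sup>+x\<in>{0..}. ennreal (exp (- x / 8)) \<partial>lborel) = ennreal (0 - (- 8 * exp (- 0 / 8)))"
    by (rule nn_integral_FTC_atLeast[OF _ _ _ lim]) (auto intro!: derivative_eq_intros)
  then have I: "(\<integral>\<^sup>+x\<in>{0..}. ennreal (exp (- x / 8)) \<partial>lborel) = 8" by simp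
  have "(\<integral>\<^sup>+x\<in>{0..}. ennreal (x ^ m * exp (- x / 4)) \<partial>lborel)
      \<le> (\<integral>\<^sup>+x. ennreal ((8 * real m) ^ m) * (ennreal (exp (- x / 8)) * indicator {0..} x) \<partial>lborel)"
  proof (rule nn_integral_mono)
    fix x :: real
    have "x ^ m * exp (- x / 4) \<le> (8 * real m) ^ m * exp (- x / 8)" if "x \<ge> 0"
    proof -
      have "x ^ m * exp (- x / 4) \<le> (8 * real m) ^ m * exp (x / 8) * exp (- x / 4)"
        using power_le_exp[OF that, of m] by (intro mult_right_mono) auto
      then show ?thesis by (simp add: mult.assoc flip: exp_add)
    qed
    then show "ennreal (x ^ m * exp (- x / 4)) * indicator {0..} x
        \<le> ennreal ((8 * real m) ^ m) * (ennreal (exp (- x / 8)) * indicator {0..} x)"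
      by (auto simp: indicator_def simp flip: ennreal_mult intro!: ennreal_leI)
  qed
  also have "\<dots> = ennreal ((8 * real m) ^ m) * 8"
    unfolding I[symmetric] by (rule nn_integral_cmult) measurable
  also have "\<dots> = ennreal (8 * (8 * real m) ^ m)"
    by (simp add: ennreal_mult mult.commute)
  finally show ?thesis .
qed

definition halfline_const :: "nat \<Rightarrow> real" where
  "halfline_const m = 1 + 32 * 2 ^ m * (8 * real m) ^ m"

text \<open>
  Changing the weight by \<open>exp (2 kap x)\<close> costs only a factor of exponential size in the degree, if
  the unit of length is chosen so that the linear part of \<open>q\<close> has slope \<open>n - kap\<close>. On \<open>[0,1]\<close> this is
  clear from \<open>kap \<le> n/4\<close>. On \<open>[1,\<infinity>)\<close>, the level \<open>M\<close> is what links the two regions: it bounds \<open>q\<close>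
  minus its linear part from below there, and on \<open>[0,1]\<close> it is an upper bound up to an error \<open>u\<close> with
  small integral. Off a set of small measure both \<open>u\<close> and the minorant of \<open>p\<close> are under control, so
  the right-hand integral is at least \<open>exp (2 l - M)\<close>, up to a factor exponential in \<open>n\<close> and \<open>S\<close>; and the growth
  bound for \<open>p\<close> shows that the tail of the left-hand integral is at most \<open>exp (2 l - M)\<close>, up to a
  factor exponential in \<open>n\<close>.
\<close>

lemma half_line_inequality:
  fixes p :: "complex poly" and q :: "real \<Rightarrow> real"
  assumes "n \<ge> 1" "degree p \<le> n" and [measurable]: "q \<in> borel_measurable borel"
    and kap: "0 \<le> kap" "4 * kap \<le> real n" and S: "S \<ge> 0"
    and lower: "AE x in lborel. 1 \<le> x \<longrightarrow> M + (real n - kap) * x \<le> q x"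
    and upper: "(\<integral>\<^sup>+x\<in>{0..1}. ennreal (max 0 (q x - (real n - kap) * x - M)) \<partial>lborel) \<le> ennreal S"
  shows "(\<integral>\<^sup>+x\<in>{0..}. ennreal (x ^ m * (cmod (poly p (of_real x)))\<^sup>2 * exp (- q x + kap * x)) \<partial>lborel)
    \<le> ennreal (halfline_const m * (256 * exp 81) ^ n * exp (4 * S)) *
      (\<integral>\<^sup>+x\<in>{0..}. ennreal (x ^ m * (cmod (poly p (of_real x)))\<^sup>2 * exp (- q x - kap * x)) \<partial>lborel)"
    (is "?F \<le> _ * ?G")
proof (cases "p = 0")
  case True
  then show ?thesis by simp
next
  case False
  then have "log_minorized n p"
    using log_minorized_mono[OF log_minorized_degree \<open>degree p \<le> n\<close>] by simp
  then obtain l k where [measurable]: "k \<in> borel_measurable borel" and k: "\<And>x. 0 \<le> k x"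
     "(\<integral>\<^sup>+x\<in>{0..1}. ennreal (k x) \<partial>lborel) \<le> ennreal (10 * real n)"
     "AE x in lborel. x \<in> {0..1} \<longrightarrow> exp (l - k x) \<le> cmod (poly p (of_real x))"
     "\<And>x. 0 \<le> x \<Longrightarrow> cmod (poly p (of_real x)) \<le> (2 * (x + 1)) ^ n * exp l"
    unfolding log_minorized_def by blast
  have [measurable]: "(\<lambda>x. poly p (of_real x)) \<in> borel_measurable borel"
    by (intro borel_measurable_continuous_onI continuous_intros)
  define u where "u = (\<lambda>x. max 0 (q x - (real n - kap) * x - M))"
  have [measurable]: "u \<in> borel_measurable borel" unfolding u_def by measurable
  have u: "u x \<ge> 0" "q x \<le> M + (real n - kap) * x + u x" for x unfolding u_def by auto
  define C where "C = 20 * real n + S"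
  have C: "C > 0" unfolding C_def using \<open>n \<ge> 1\<close> S by auto
  define E where "E = {x \<in> {1/2..1}. 2 * k x + u x \<le> 4 * C}"
  have [measurable]: "E \<in> sets borel" unfolding E_def by measurable
  have "(\<integral>\<^sup>+x\<in>{0..1}. ennreal (2 * k x + u x) \<partial>lborel)
     = (\<integral>\<^sup>+x. 2 * (ennreal (k x) * indicator {0..1} x) + ennreal (u x) * indicator {0..1} x \<partial>lborel)"
    using k(1) u(1) by (intro nn_integral_cong) (simp add: distrib_right ennreal_mult mult.assoc)
  also have "\<dots> = 2 * (\<integral>\<^sup>+x\<in>{0..1}. ennreal (k x) \<partial>lborel) + (\<integral>\<^sup>+x\<in>{0..1}. ennreal (u x) \<partial>lborel)"
    by (subst nn_integral_add) (simp_all add: nn_integral_cmult)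
  also have "\<dots> \<le> 2 * ennreal (10 * real n) + ennreal S"
    using upper k(2) unfolding u_def by (intro add_mono mult_left_mono) auto
  also have "\<dots> = ennreal C"
    unfolding C_def using S by (simp add: ennreal_mult ennreal_plus mult.assoc[symmetric])
  finally have E: "ennreal (1/4) \<le> emeasure lborel E"
    unfolding E_def by (intro emeasure_sublevel_ge C) measurable
  \<comment> \<open>A pointwise lower bound of the right-hand integrand on \<open>E\<close>.\<close>
  define D where "D = exp (2 * l - M - real n - 4 * C) * (1/2) ^ m"
  have "ennreal D * ennreal (1/4) \<le> ennreal D * emeasure lborel E"
    by (intro mult_left_mono E) auto
  also have "\<dots> = (\<integral>\<^sup>+x. ennreal D * indicator E x \<partial>lborel)"
    by (simp add: nn_integral_cmult)
  also have "\<dots> \<le> ?G"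
  proof (rule nn_integral_mono_AE, use k(3) in eventually_elim)
    case (elim x)
    show ?case
    proof (cases "x \<in> E")
      case True
      then have x: "1/2 \<le> x" "x \<le> 1" "2 * k x + u x \<le> 4 * C" by (auto simp: E_def)
      have "exp (l - k x) \<le> cmod (poly p (of_real x))" using elim x by auto
      then have 1: "exp (2 * (l - k x)) \<le> (cmod (poly p (of_real x)))\<^sup>2"
        unfolding exp_double by (intro power_mono) auto
      have "q x + kap * x \<le> M + u x + real n * x"
        using u(2)[of x] by (simp add: algebra_simps)
      also have "\<dots> \<le> M + u x + real n * 1"
        using x by (intro add_left_mono mult_left_mono) auto
      finally have 2: "exp (- (M + u x + real n)) \<le> exp (- q x - kap * x)" by simp
      have 3: "(1/2) ^ m \<le> x ^ m" using x by (intro power_mono) auto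
      have "exp (2 * l - M - real n - 4 * C) \<le> exp (2 * (l - k x)) * exp (- (M + u x + real n))"
        using x by (simp flip: exp_add)
      then have "D \<le> exp (2 * (l - k x)) * exp (- (M + u x + real n)) * (1/2) ^ m"
        unfolding D_def by (intro mult_right_mono) auto
      also have "\<dots> \<le> (cmod (poly p (of_real x)))\<^sup>2 * exp (- q x - kap * x) * x ^ m"
        using 1 2 3 by (intro mult_mono) auto
      finally show ?thesis using x True by (auto simp: mult_ac intro!: ennreal_leI)
    qed auto
  qed
  also have "ennreal D * ennreal (1/4) = ennreal (D / 4)"
    by (subst ennreal_mult[symmetric]) (auto simp: D_def)
  finally have DG: "ennreal (D / 4) \<le> ?G" .
  define H where "H = exp (2 * l - M) * 256 ^ n"
  have "?F \<le> (\<integral>\<^sup>+x. ennreal (exp (real n)) * (ennreal (x ^ m * (cmod (poly p (of_real x)))\<^sup>2 * exp (- q x - kap * x)) * indicator {0..} x)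
     + ennreal H * (ennreal (x ^ m * exp (- x / 4)) * indicator {0..} x) \<partial>lborel)"
  proof (rule nn_integral_mono_AE, use lower in eventually_elim)
    case (elim x)
    consider "x < 0" | "0 \<le> x" "x < 1" | "1 \<le> x" by linarith
    then show ?case
    proof cases
      case 2
      have "2 * (kap * x) \<le> 2 * (kap * 1)"
        using kap 2 by (intro mult_left_mono) auto
      then have "exp (- q x + kap * x) \<le> exp (real n) * exp (- q x - kap * x)"
        using kap unfolding exp_add[symmetric] by simp
      then have "x ^ m * (cmod (poly p (of_real x)))\<^sup>2 * exp (- q x + kap * x)
         \<le> x ^ m * (cmod (poly p (of_real x)))\<^sup>2 * (exp (real n) * exp (- q x - kap * x))"
        using 2 by (intro mult_left_mono) auto
      then show ?thesis using 2
        by (auto simp: mult_ac simp flip: ennreal_mult intro!: add_increasing2 ennreal_leI)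
    next
      case 3
      have "x + 1 \<le> 8 * exp (x / 8)" using exp_ge_add_one_self[of "x / 8"] by linarith
      then have "(x + 1)\<^sup>2 \<le> (8 * exp (x / 8))\<^sup>2" using 3 by (intro power_mono) auto
      then have "(2 * (x + 1))\<^sup>2 \<le> 256 * exp (x / 4)"
        using exp_double[of "x / 8"] by (simp add: power2_eq_square algebra_simps)
      then have "((2 * (x + 1))\<^sup>2) ^ n \<le> (256 * exp (x / 4)) ^ n"
        by (intro power_mono) auto
      also have "\<dots> = 256 ^ n * exp (real n * (x / 4))"
        by (simp only: power_mult_distrib exp_of_nat_mult)
      finally have pw: "((2 * (x + 1))\<^sup>2) ^ n \<le> 256 ^ n * exp (real n * (x / 4))" .
      have "(cmod (poly p (of_real x)))\<^sup>2 \<le> ((2 * (x + 1)) ^ n * exp l)\<^sup>2"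
        using k(4)[of x] 3 by (intro power_mono) auto
      also have "\<dots> = ((2 * (x + 1))\<^sup>2) ^ n * exp (2 * l)"
        by (simp add: power_mult_distrib exp_double flip: power_mult) (simp add: mult.commute)
      also have "\<dots> \<le> 256 ^ n * exp (real n * (x / 4)) * exp (2 * l)"
        using pw by (intro mult_right_mono) auto
      finally have P: "(cmod (poly p (of_real x)))\<^sup>2 \<le> 256 ^ n * exp (real n * (x / 4)) * exp (2 * l)" .
      \<comment> \<open>Of the slope \<open>n - 2 kap \<ge> n/2\<close> that remains, \<open>n/4\<close> compensates the growth of \<open>p\<close>
        and \<open>n/4 \<ge> 1/4\<close> makes the tail integrable.\<close>
      have "(4 * kap) * x \<le> real n * x" "1 * x \<le> real n * x"
        using kap 3 \<open>n \<ge> 1\<close> by (auto intro!: mult_right_mono)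
      moreover have "M + real n * x - kap * x \<le> q x"
        using elim 3 by (simp add: algebra_simps)
      ultimately have "- q x + kap * x \<le> - M - x / 4 - real n * (x / 4)"
        by linarith
      then have "exp (- q x + kap * x) \<le> exp (- M - x / 4 - real n * (x / 4))" by simp
      with P have "(cmod (poly p (of_real x)))\<^sup>2 * exp (- q x + kap * x)
         \<le> (256 ^ n * exp (real n * (x / 4)) * exp (2 * l)) * exp (- M - x / 4 - real n * (x / 4))"
        by (intro mult_mono) auto
      also have "\<dots> = H * exp (- x / 4)"
        unfolding H_def by (simp add: mult_ac) (simp flip: exp_add)
      finally have "x ^ m * ((cmod (poly p (of_real x)))\<^sup>2 * exp (- q x + kap * x)) \<le> x ^ m * (H * exp (- x / 4))"
        using 3 by (intro mult_left_mono) auto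
      moreover have "H \<ge> 0" by (simp add: H_def)
      ultimately show ?thesis using 3
        by (auto simp: mult_ac simp flip: ennreal_mult intro!: add_increasing ennreal_leI)
    qed auto
  qed
  also have "\<dots> = ennreal (exp (real n)) * ?G + ennreal H * (\<integral>\<^sup>+x\<in>{0..}. ennreal (x ^ m * exp (- x / 4)) \<partial>lborel)"
    by (subst nn_integral_add) (simp_all add: nn_integral_cmult)
  also have "\<dots> \<le> ennreal (exp (real n)) * ?G + ennreal H * ennreal (8 * (8 * real m) ^ m)"
    by (intro add_left_mono mult_left_mono nn_integral_power_exp_le) auto
  also have "ennreal H * ennreal (8 * (8 * real m) ^ m)
      = ennreal (32 * 2 ^ m * (8 * real m) ^ m * (256 * exp 81) ^ n * exp (4 * S)) * ennreal (D / 4)"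
  proof -
    have "exp (2 * l - M) = exp (2 * l - M - real n - 4 * C) * exp (real n * 81) * exp (4 * S)"
      unfolding C_def by (simp flip: exp_add)
    then have "H * (8 * (8 * real m) ^ m)
      = (32 * 2 ^ m * (8 * real m) ^ m * (256 * exp 81) ^ n * exp (4 * S)) * (D / 4)"
      unfolding H_def D_def by (simp add: power_mult_distrib exp_of_nat_mult power_one_over)
    then show ?thesis by (simp add: H_def D_def flip: ennreal_mult)
  qed
  also have "\<dots> \<le> ennreal (32 * 2 ^ m * (8 * real m) ^ m * (256 * exp 81) ^ n * exp (4 * S)) * ?G"
    by (intro mult_left_mono DG) auto
  also have "ennreal (exp (real n)) * ?G + ennreal (32 * 2 ^ m * (8 * real m) ^ m * (256 * exp 81) ^ n * exp (4 * S)) * ?G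
    = ennreal (exp (real n) + 32 * 2 ^ m * (8 * real m) ^ m * (256 * exp 81) ^ n * exp (4 * S)) * ?G"
    by (subst ennreal_plus) (auto simp: distrib_right)
  also have "\<dots> \<le> ennreal (halfline_const m * (256 * exp 81) ^ n * exp (4 * S)) * ?G"
  proof (intro mult_right_mono ennreal_leI)
    have "exp (real n) = exp 1 ^ n" by (simp flip: exp_of_nat_mult)
    also have "\<dots> \<le> (256 * exp 81) ^ n"
    proof (intro power_mono)
      have "exp 1 \<le> exp (81::real)" by simp
      also have "\<dots> \<le> 256 * exp 81" by simp
      finally show "exp 1 \<le> 256 * exp (81::real)" .
    qed auto
    also have "\<dots> \<le> (256 * exp 81) ^ n * exp (4 * S)"
      using mult_left_mono[of 1 "exp (4 * S)" "(256 * exp 81) ^ n"] S by simp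
    finally show "exp (real n) + 32 * 2 ^ m * (8 * real m) ^ m * (256 * exp 81) ^ n * exp (4 * S)
      \<le> halfline_const m * (256 * exp 81) ^ n * exp (4 * S)"
      unfolding halfline_const_def by (simp add: algebra_simps)
  qed auto
  finally show ?thesis by (simp add: add_left_mono)
qed

section \<open>Integration along rays\<close>

lemma nn_integral_scaleR:
  fixes f :: "'a::euclidean_space \<Rightarrow> ennreal"
  assumes [measurable]: "f \<in> borel_measurable borel" and "c > 0"
  shows "(\<integral>\<^sup>+x. f x \<partial>lborel) = ennreal (c ^ DIM('a)) * (\<integral>\<^sup>+x. f (c *\<^sub>R x) \<partial>lborel)"
  using \<open>c > 0\<close>
  by (subst lborel_affine[of c 0]) (simp_all add: nn_integral_density nn_integral_distr nn_integral_cmult)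

text \<open>
  The integral of \<open>F\<close> along the ray through \<open>\<xi>\<close>, with the density of polar coordinates.
\<close>

definition ray_integral :: "('a::euclidean_space \<Rightarrow> ennreal) \<Rightarrow> 'a \<Rightarrow> ennreal" where
  "ray_integral F \<xi> = (\<integral>\<^sup>+s\<in>{0..}. ennreal (s ^ (DIM('a) - 1)) * F (s *\<^sub>R \<xi>) \<partial>lborel)"

lemma ray_integral_scaleR:
  fixes F :: "'a::euclidean_space \<Rightarrow> ennreal"
  assumes [measurable]: "F \<in> borel_measurable borel" and "b > 0"
  shows "ray_integral F \<xi> = ennreal (b ^ DIM('a)) * ray_integral F (b *\<^sub>R \<xi>)"
proof -
  have "b * b ^ (DIM('a) - 1) = b ^ DIM('a)"
    using DIM_positive[where 'a='a] by (cases "DIM('a)") auto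
  then have b: "ennreal b * ennreal (b ^ (DIM('a) - 1)) = ennreal (b ^ DIM('a))"
    using \<open>b > 0\<close> by (simp flip: ennreal_mult)
  have "ray_integral F \<xi> = ennreal \<bar>b\<bar> *
      (\<integral>\<^sup>+s. ennreal ((0 + b * s) ^ (DIM('a) - 1)) * F ((0 + b * s) *\<^sub>R \<xi>) * indicator {0..} (0 + b * s) \<partial>lborel)"
    unfolding ray_integral_def using \<open>b > 0\<close> by (intro nn_integral_real_affine) auto
  also have "(\<integral>\<^sup>+s. ennreal ((0 + b * s) ^ (DIM('a) - 1)) * F ((0 + b * s) *\<^sub>R \<xi>) * indicator {0..} (0 + b * s) \<partial>lborel)
    = (\<integral>\<^sup>+s. ennreal (b ^ (DIM('a) - 1)) * (ennreal (s ^ (DIM('a) - 1)) * F (s *\<^sub>R b *\<^sub>R \<xi>) * indicator {0..} s) \<partial>lborel)"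
    using \<open>b > 0\<close>
    by (intro nn_integral_cong)
      (auto simp: indicator_def zero_le_mult_iff power_mult_distrib ennreal_mult mult_ac)
  also have "\<dots> = ennreal (b ^ (DIM('a) - 1)) * ray_integral F (b *\<^sub>R \<xi>)"
    unfolding ray_integral_def by (rule nn_integral_cmult) measurable
  finally show ?thesis using \<open>b > 0\<close> by (simp only: abs_of_pos b mult.assoc[symmetric])
qed

text \<open>
  A form of polar coordinates that needs no measure on the sphere: averaging over directions is
  replaced by averaging over \<open>\<xi>\<close> against a weight \<open>g\<close> that satisfies
  \<open>\<integral> g(\<eta>/s) ds/s = 1\<close> for every \<open>\<eta> \<noteq> 0\<close>. The identity is then Fubini's theorem together with the
  scaling of Lebesgue measure. For \<open>g(\<xi>) = 1/\<bar>\<xi>\<bar>\<close> on \<open>\<bar>\<xi>\<bar> \<ge> 1\<close> the normalization amounts to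
  the length of an interval.
\<close>

lemma nn_integral_eq_ray_integral:
  fixes F :: "'a::euclidean_space \<Rightarrow> ennreal"
  assumes [measurable]: "F \<in> borel_measurable borel"
  shows "(\<integral>\<^sup>+\<xi>. F \<xi> \<partial>lborel) =
    (\<integral>\<^sup>+\<xi>. ennreal (indicator {1..} (norm \<xi>) / norm \<xi>) * ray_integral F \<xi> \<partial>lborel)"
proof -
  interpret lborel_pair: pair_sigma_finite "lborel :: 'a measure" "lborel :: real measure" ..
  define g :: "'a \<Rightarrow> ennreal" where "g = (\<lambda>\<xi>. ennreal (indicator {1..} (norm \<xi>) / norm \<xi>))"
  have [measurable]: "g \<in> borel_measurable borel" unfolding g_def by measurable
  have unit: "(\<integral>\<^sup>+s\<in>{0..}. ennreal (1 / s) * g (\<eta> /\<^sub>R s) \<partial>lborel) = 1" if "\<eta> \<noteq> 0" for \<eta>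
  proof -
    have "(\<integral>\<^sup>+s\<in>{0..}. ennreal (1 / s) * g (\<eta> /\<^sub>R s) \<partial>lborel)
        = (\<integral>\<^sup>+s. ennreal (1 / norm \<eta>) * indicator {0..norm \<eta>} s \<partial>lborel)"
    proof (rule nn_integral_cong_AE, use AE_lborel_singleton[of 0] in eventually_elim)
      case (elim s)
      then show ?case
        using that by (auto simp: g_def indicator_def field_simps simp flip: ennreal_mult)
    qed
    also have "\<dots> = ennreal (1 / norm \<eta>) * ennreal (norm \<eta>)"
      by (simp add: nn_integral_cmult)
    also have "\<dots> = 1" using that by (simp flip: ennreal_mult)
    finally show ?thesis .
  qed
  have slice: "(\<integral>\<^sup>+\<xi>. g \<xi> * (ennreal (s ^ (DIM('a) - 1)) * F (s *\<^sub>R \<xi>)) \<partial>lborel)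
     = (\<integral>\<^sup>+\<eta>. F \<eta> * (ennreal (1 / s) * g (\<eta> /\<^sub>R s)) \<partial>lborel)" if "s > 0" for s :: real
  proof -
    have "s ^ DIM('a) * (1 / s) = s ^ (DIM('a) - 1)"
      using that DIM_positive[where 'a='a] by (cases "DIM('a)") auto
    then have s: "ennreal (s ^ DIM('a)) * ennreal (1 / s) = ennreal (s ^ (DIM('a) - 1))"
      using that by (simp flip: ennreal_mult)
    have "(\<integral>\<^sup>+\<eta>. F \<eta> * (ennreal (1 / s) * g (\<eta> /\<^sub>R s)) \<partial>lborel)
       = ennreal (s ^ DIM('a)) * (\<integral>\<^sup>+\<xi>. F (s *\<^sub>R \<xi>) * (ennreal (1 / s) * g ((s *\<^sub>R \<xi>) /\<^sub>R s)) \<partial>lborel)"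
      using that by (intro nn_integral_scaleR) auto
    also have "\<dots> = (\<integral>\<^sup>+\<xi>. ennreal (s ^ DIM('a)) * (F (s *\<^sub>R \<xi>) * (ennreal (1 / s) * g \<xi>)) \<partial>lborel)"
      using that by (subst nn_integral_cmult) simp_all
    also have "\<dots> = (\<integral>\<^sup>+\<xi>. g \<xi> * (ennreal (s ^ (DIM('a) - 1)) * F (s *\<^sub>R \<xi>)) \<partial>lborel)"
      unfolding s[symmetric] by (simp add: mult_ac)
    finally show ?thesis by simp
  qed
  have "(\<integral>\<^sup>+\<xi>. g \<xi> * ray_integral F \<xi> \<partial>lborel)
     = (\<integral>\<^sup>+\<xi>. \<integral>\<^sup>+s. g \<xi> * (ennreal (s ^ (DIM('a) - 1)) * F (s *\<^sub>R \<xi>)) * indicator {0..} s \<partial>lborel \<partial>lborel)"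
    unfolding ray_integral_def by (simp add: nn_integral_cmult mult.assoc)
  also have "\<dots> = (\<integral>\<^sup>+s. \<integral>\<^sup>+\<xi>. g \<xi> * (ennreal (s ^ (DIM('a) - 1)) * F (s *\<^sub>R \<xi>)) * indicator {0..} s \<partial>lborel \<partial>lborel)"
    by (rule lborel_pair.Fubini'[symmetric]) measurable
  also have "\<dots> = (\<integral>\<^sup>+s. \<integral>\<^sup>+\<eta>. F \<eta> * (ennreal (1 / s) * g (\<eta> /\<^sub>R s)) * indicator {0..} s \<partial>lborel \<partial>lborel)"
  proof (rule nn_integral_cong_AE, use AE_lborel_singleton[of 0] in eventually_elim)
    case (elim s)
    then show ?case
      using slice[of s] by (cases "s > 0") auto
  qed
  also have "\<dots> = (\<integral>\<^sup>+\<eta>. \<integral>\<^sup>+s. F \<eta> * (ennreal (1 / s) * g (\<eta> /\<^sub>R s)) * indicator {0..} s \<partial>lborel \<partial>lborel)"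
    by (rule lborel_pair.Fubini') measurable
  also have "\<dots> = (\<integral>\<^sup>+\<eta>. F \<eta> * (\<integral>\<^sup>+s\<in>{0..}. ennreal (1 / s) * g (\<eta> /\<^sub>R s) \<partial>lborel) \<partial>lborel)"
    by (simp add: nn_integral_cmult mult.assoc)
  also have "\<dots> = (\<integral>\<^sup>+\<eta>. F \<eta> \<partial>lborel)"
  proof (rule nn_integral_cong_AE, use AE_lborel_singleton[of 0] in eventually_elim)
    case (elim \<eta>)
    then show ?case by (simp add: unit)
  qed
  finally show ?thesis unfolding g_def by simp
qed

text \<open>
  Since ray integrals at proportional points are proportional with a factor independent of the
  integrand, an inequality between them need be tested only on one sphere.
\<close>

lemma nn_integral_le_if_ray_integral_le:
  fixes F G :: "'a::euclidean_space \<Rightarrow> ennreal"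
  assumes [measurable]: "F \<in> borel_measurable borel" "G \<in> borel_measurable borel" and "T > 0"
    and ray: "\<And>\<xi>. norm \<xi> = T \<Longrightarrow> ray_integral F \<xi> \<le> A * ray_integral G \<xi>"
  shows "(\<integral>\<^sup>+\<xi>. F \<xi> \<partial>lborel) \<le> A * (\<integral>\<^sup>+\<xi>. G \<xi> \<partial>lborel)"
proof -
  have [measurable]: "ray_integral G \<in> borel_measurable borel"
    unfolding ray_integral_def by measurable
  have "ray_integral F \<xi> \<le> A * ray_integral G \<xi>" if "\<xi> \<noteq> 0" for \<xi>
  proof -
    define b where "b = T / norm \<xi>"
    have b: "b > 0" "norm (b *\<^sub>R \<xi>) = T" using that \<open>T > 0\<close> unfolding b_def by auto
    have "ennreal (b ^ DIM('a)) * ray_integral F (b *\<^sub>R \<xi>)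
        \<le> ennreal (b ^ DIM('a)) * (A * ray_integral G (b *\<^sub>R \<xi>))"
      by (intro mult_left_mono ray b) auto
    then show ?thesis
      using ray_integral_scaleR[of F b \<xi>] ray_integral_scaleR[of G b \<xi>] b by (simp add: mult_ac)
  qed
  then have "ennreal (indicator {1..} (norm \<xi>) / norm \<xi>) * ray_integral F \<xi>
      \<le> A * (ennreal (indicator {1..} (norm \<xi>) / norm \<xi>) * ray_integral G \<xi>)" for \<xi> :: 'a
    by (cases "\<xi> = 0") (auto simp: mult.left_commute[of A] intro!: mult_left_mono)
  then have "(\<integral>\<^sup>+\<xi>. F \<xi> \<partial>lborel)
      \<le> (\<integral>\<^sup>+\<xi>. A * (ennreal (indicator {1..} (norm \<xi>) / norm \<xi>) * ray_integral G \<xi>) \<partial>lborel)"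
    unfolding nn_integral_eq_ray_integral[OF assms(1)] by (intro nn_integral_mono) auto
  also have "\<dots> = A * (\<integral>\<^sup>+\<xi>. G \<xi> \<partial>lborel)"
    unfolding nn_integral_eq_ray_integral[OF assms(2)] by (rule nn_integral_cmult) measurable
  finally show ?thesis .
qed

text \<open>
  The integral of the indicator of a null set along each ray of unit direction vanishes.
\<close>

lemma AE_norm:
  assumes "AE r in lborel. 0 \<le> r \<longrightarrow> P r"
  shows "AE \<xi> in (lborel :: 'a::euclidean_space measure). P (norm \<xi>)"
proof -
  obtain N where N: "N \<in> null_sets lborel" "{r. \<not> (0 \<le> r \<longrightarrow> P r)} \<subseteq> N"
    using assms by (auto elim!: AE_E simp: null_sets_def)
  then have [measurable]: "N \<in> sets borel" by auto
  have "(\<integral>\<^sup>+\<xi>. indicator N (norm (\<xi>::'a)) \<partial>lborel) \<le> 0 * (\<integral>\<^sup>+\<xi>. 0 \<partial>(lborel :: 'a measure))"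
  proof (rule nn_integral_le_if_ray_integral_le[where T = 1])
    fix \<xi> :: 'a assume "norm \<xi> = 1"
    have "ray_integral (\<lambda>\<xi>. indicator N (norm \<xi>)) \<xi> = (\<integral>\<^sup>+s. 0 \<partial>(lborel :: real measure))"
      unfolding ray_integral_def
    proof (rule nn_integral_cong_AE, use AE_not_in[OF N(1)] in eventually_elim)
      case (elim s)
      then show ?case using \<open>norm \<xi> = 1\<close> by (auto simp: indicator_def)
    qed
    then show "ray_integral (\<lambda>\<xi>. indicator N (norm \<xi>)) \<xi> \<le> 0 * ray_integral (\<lambda>\<xi>. 0) \<xi>" by simp
  qed auto
  then have "AE \<xi> in lborel. indicator N (norm (\<xi>::'a)) = (0::ennreal)"
    by (subst (asm) mult_zero_left, subst nn_integral_0_iff_AE[symmetric]) auto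
  then show ?thesis
  proof eventually_elim
    case (elim \<xi>)
    then have "norm \<xi> \<notin> N" by (auto simp: indicator_def split: if_splits)
    with N(2) have "0 \<le> norm \<xi> \<longrightarrow> P (norm \<xi>)" by blast
    then show ?case by simp
  qed
qed

section \<open>The lower envelope and the oscillation\<close>

lemma sublevel_sets_lebesgue:
  fixes R :: "real \<Rightarrow> real"
  assumes "R \<in> borel_measurable (lebesgue_on {0..})" "0 \<le> t"
  shows "{s. s \<ge> t \<and> R s \<le> (c::real)} \<in> sets lebesgue"
proof -
  have "{s \<in> space (lebesgue_on {0..}). R s \<le> c} \<in> sets (lebesgue_on {0..})"
    using assms(1) by measurable
  then have "{s \<in> {0..}. R s \<le> c} \<in> sets lebesgue"
    by (subst (asm) sets_restrict_space_iff) auto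
  then have "{t..} \<inter> {s \<in> {0..}. R s \<le> c} \<in> sets lebesgue" by auto
  also have "{t..} \<inter> {s \<in> {0..}. R s \<le> c} = {s. s \<ge> t \<and> R s \<le> c}" using \<open>0 \<le> t\<close> by auto
  finally show ?thesis .
qed

lemma Qm_mono:
  fixes R :: "real \<Rightarrow> real"
  assumes "R \<in> borel_measurable (lebesgue_on {0..})" "0 \<le> r" "r \<le> t"
  shows "Qm R r \<le> Qm R t"
  unfolding Qm_def
proof (intro Inf_superset_mono image_mono subsetI CollectI)
  fix c assume "c \<in> {c. 0 < emeasure lebesgue {s. t \<le> s \<and> R s \<le> c}}"
  then have "0 < emeasure lebesgue {s. t \<le> s \<and> R s \<le> c}" by simp
  also have "\<dots> \<le> emeasure lebesgue {s. r \<le> s \<and> R s \<le> c}"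
    using assms by (intro emeasure_mono sublevel_sets_lebesgue) auto
  finally show "0 < emeasure lebesgue {s. r \<le> s \<and> R s \<le> c}" .
qed

text \<open>
  The sublevel sets of a real-valued function exhaust \<open>[t,\<infinity>)\<close>, so one of them is not null.
\<close>

lemma Qm_not_PInf:
  fixes R :: "real \<Rightarrow> real"
  assumes "R \<in> borel_measurable (lebesgue_on {0..})" "0 \<le> t"
  shows "Qm R t \<noteq> \<infinity>"
proof
  assume *: "Qm R t = \<infinity>"
  have "emeasure lebesgue {s. t \<le> s \<and> R s \<le> c} = 0" for c
  proof (rule ccontr)
    assume "emeasure lebesgue {s. t \<le> s \<and> R s \<le> c} \<noteq> 0"
    then have "Qm R t \<le> ereal c"
      unfolding Qm_def by (intro Inf_lower imageI CollectI) (simp add: zero_less_iff_neq_zero)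
    with * show False by simp
  qed
  then have "{s. t \<le> s \<and> R s \<le> real k} \<in> null_sets lebesgue" for k
    using sublevel_sets_lebesgue[OF assms] by auto
  then have "(\<Union>k. {s. t \<le> s \<and> R s \<le> real k}) \<in> null_sets lebesgue"
    by (intro null_sets_UN) auto
  moreover have "(\<Union>k. {s. t \<le> s \<and> R s \<le> real k}) = {t..}"
    using real_arch_simple by fastforce
  ultimately have "negligible {t..}" by (simp add: negligible_iff_null_sets)
  then have "negligible (cbox t (t + 1))" by (rule negligible_subset) auto
  then show False by (simp only: negligible_interval box_eq_empty inner_real_def) simp
qed

lemma AE_Qm_le:
  fixes R :: "real \<Rightarrow> real"
  assumes "R \<in> borel_measurable (lebesgue_on {0..})" "0 \<le> t" "Qm R t = ereal M"
  shows "AE s in lborel. t \<le> s \<longrightarrow> M \<le> R s"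
proof -
  have "AE s in lebesgue. t \<le> s \<longrightarrow> M - 1 / real (Suc k) < R s" for k
  proof -
    let ?S = "{s. t \<le> s \<and> R s \<le> M - 1 / real (Suc k)}"
    have "emeasure lebesgue ?S = 0"
    proof (rule ccontr)
      assume "emeasure lebesgue ?S \<noteq> 0"
      then have "Qm R t \<le> ereal (M - 1 / real (Suc k))"
        unfolding Qm_def by (intro Inf_lower imageI CollectI) (simp add: zero_less_iff_neq_zero)
      with assms(3) show False by simp
    qed
    then have "?S \<in> null_sets lebesgue"
      using sublevel_sets_lebesgue[OF assms(1,2)] by auto
    from AE_not_in[OF this] show ?thesis by eventually_elim auto
  qed
  then have "AE s in lebesgue. \<forall>k::nat. t \<le> s \<longrightarrow> M - 1 / real (Suc k) < R s"
    unfolding AE_all_countable by blast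
  then have "AE s in lborel. \<forall>k::nat. t \<le> s \<longrightarrow> M - 1 / real (Suc k) < R s"
    by (simp only: AE_completion_iff)
  then show ?thesis
  proof (rule AE_mp, intro AE_I2 impI)
    fix s assume *: "\<forall>k::nat. t \<le> s \<longrightarrow> M - 1 / real (Suc k) < R s" and "t \<le> s"
    show "M \<le> R s"
    proof (rule field_le_epsilon)
      fix e :: real assume "0 < e"
      then obtain k where "1 / real (Suc k) < e" by (rule nat_approx_posE)
      moreover have "M - 1 / real (Suc k) < R s" using * \<open>t \<le> s\<close> by blast
      ultimately show "M \<le> R s + e" by linarith
    qed
  qed
qed

lemma AE_lborel_mult:
  fixes T :: real
  assumes "T > 0" "AE x in lborel. P x"
  shows "AE x in lborel. P (T * x)"
proof -
  obtain N where N: "N \<in> null_sets lborel" "{x. \<not> P x} \<subseteq> N"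
    using assms(2) by (auto elim!: AE_E simp: null_sets_def)
  then have [measurable]: "N \<in> sets borel" by auto
  have "0 = (\<integral>\<^sup>+x. indicator N x \<partial>lborel)" using N by auto
  also have "\<dots> = ennreal \<bar>T\<bar> * (\<integral>\<^sup>+x. indicator N (0 + T * x) \<partial>lborel)"
    using \<open>T > 0\<close> by (intro nn_integral_real_affine) auto
  finally have "(\<integral>\<^sup>+x. indicator N (T * x) \<partial>lborel) = 0"
    using \<open>T > 0\<close> by auto
  then have "AE x in lborel. indicator N (T * x) = (0::ennreal)"
    by (subst nn_integral_0_iff_AE[symmetric]) auto
  then show ?thesis
  proof eventually_elim
    case (elim x)
    then show ?case using N(2) by (auto simp: indicator_def split: if_splits)
  qed
qed

text \<open>
  Substituting \<open>x = cos \<theta>\<close> brings in the factor \<open>sin \<theta> \<le> 1\<close>.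
\<close>

lemma nn_integral_le_nn_integral_cos:
  fixes h :: "real \<Rightarrow> real"
  assumes [measurable]: "h \<in> borel_measurable borel" and "\<And>x. 0 \<le> h x"
  shows "(\<integral>\<^sup>+x\<in>{0..1}. ennreal (h x) \<partial>lborel) \<le> (\<integral>\<^sup>+\<theta>\<in>{0..pi/2}. ennreal (h (cos \<theta>)) \<partial>lborel)"
proof -
  have "(\<integral>\<^sup>+x\<in>{0..1}. ennreal (h x) \<partial>lborel)
      = ennreal \<bar>-1\<bar> * (\<integral>\<^sup>+x. ennreal (h (0 + (-1) * x)) * indicator {0..1} (0 + (-1) * x) \<partial>lborel)"
    by (rule nn_integral_real_affine) auto
  also have "\<dots> = (\<integral>\<^sup>+x. ennreal (h (- x) * indicator {- cos 0..- cos (pi/2)} x) \<partial>lborel)"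
    by (auto intro!: nn_integral_cong simp: indicator_def)
  also have "\<dots> = (\<integral>\<^sup>+\<theta>. ennreal (h (- (- cos \<theta>)) * sin \<theta> * indicator {0..pi/2} \<theta>) \<partial>lborel)"
    by (rule nn_integral_substitution)
      (auto simp: set_borel_measurable_def sin_ge_zero intro!: derivative_eq_intros continuous_intros)
  also have "\<dots> \<le> (\<integral>\<^sup>+\<theta>\<in>{0..pi/2}. ennreal (h (cos \<theta>)) \<partial>lborel)"
    using assms(2) by (intro nn_integral_mono)
      (auto simp: indicator_def mult_left_le intro!: ennreal_leI)
  finally show ?thesis .
qed

text \<open>
  The level is \<open>M = Qm (QL L Q) T\<close>. It is finite: if it were \<open>-\<infinity>\<close>, then by monotonicity so would
  be \<open>Qm (QL L Q)\<close> on all of \<open>[0,T]\<close>, and the integral in the hypothesis would diverge. By definition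
  \<open>M\<close> bounds \<open>QL L Q\<close> from below almost everywhere on \<open>[T,\<infinity>)\<close>. By monotonicity again, the excess
  of \<open>QL L Q\<close> over \<open>M\<close> on \<open>[0,T]\<close> is at most \<open>Qo (QL L Q)\<close>.
\<close>

lemma oscillation_bound:
  assumes Q: "Q \<in> borel_measurable (lebesgue_on {0..})" and [measurable]: "q \<in> borel_measurable borel"
    and eq: "AE r in lborel. 0 \<le> r \<longrightarrow> Q r = q r" and T: "T > 0"
    and hyp: "(\<integral>\<^sup>+\<theta>\<in>{0..pi/2}. e2ennreal (Qo (QL L Q) (T * cos \<theta>)) \<partial>lebesgue) < ennreal C"
  obtains M where "AE x in lborel. 1 \<le> x \<longrightarrow> M + L * T * x \<le> q (T * x)"
    and "(\<integral>\<^sup>+x\<in>{0..1}. ennreal (max 0 (q (T * x) - L * T * x - M)) \<partial>lborel) \<le> ennreal C"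
proof -
  define R where "R = QL L Q"
  have R: "R \<in> borel_measurable (lebesgue_on {0..})"
  proof -
    have [measurable]: "(\<lambda>x. x) \<in> borel_measurable (lebesgue_on {0::real..})"
      by (intro continuous_imp_measurable_on_sets_lebesgue continuous_intros) auto
    show ?thesis unfolding R_def QL_def using Q by measurable
  qed
  have Qm_le: "Qm R (T * cos \<theta>) \<le> Qm R T" if "\<theta> \<in> {0..pi/2}" for \<theta>
    using that T by (intro Qm_mono R) (auto simp: cos_ge_zero mult_left_le)
  have "Qm R T \<noteq> - \<infinity>"
  proof
    assume inf: "Qm R T = - \<infinity>"
    have "Qo R (T * cos \<theta>) = \<infinity>" if "\<theta> \<in> {0..pi/2}" for \<theta>
      using Qm_le[OF that] inf by (simp add: Qo_def)
    then have "(\<integral>\<^sup>+\<theta>\<in>{0..pi/2}. e2ennreal (Qo R (T * cos \<theta>)) \<partial>lebesgue)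
        = (\<integral>\<^sup>+\<theta>. \<infinity> * indicator {0..pi/2} \<theta> \<partial>lebesgue)"
      by (intro nn_integral_cong) (auto simp: indicator_def)
    also have "\<dots> = \<infinity>"
      by (subst nn_integral_cmult_indicator) (auto simp: ennreal_top_mult)
    finally show False using hyp unfolding R_def[symmetric] by simp
  qed
  moreover have "Qm R T \<noteq> \<infinity>" using T by (intro Qm_not_PInf R) auto
  ultimately obtain M where M: "Qm R T = ereal M"
    by (cases "Qm R T") auto
  obtain N where N: "N \<in> null_sets lborel" "{r. \<not> (0 \<le> r \<longrightarrow> Q r = q r)} \<subseteq> N"
    using eq by (auto elim!: AE_E simp: null_sets_def)
  then have [measurable]: "N \<in> sets borel" by auto
  have "AE s in lborel. T \<le> s \<longrightarrow> M + L * s \<le> q s"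
    using AE_Qm_le[OF R _ M] eq T unfolding R_def QL_def by (auto elim!: eventually_elim2)
  from AE_lborel_mult[OF T this] have lower: "AE x in lborel. 1 \<le> x \<longrightarrow> M + L * T * x \<le> q (T * x)"
    by eventually_elim (use T in \<open>auto simp: mult.assoc\<close>)
  \<comment> \<open>Vanishing where \<open>q\<close> and \<open>Q\<close> differ makes \<open>h\<close> a Borel function below the integrand at
    every angle, so that nothing need be known about the null set pulled back along the cosine.\<close>
  define h where "h = (\<lambda>x. indicator (- N) (T * x) * max 0 (q (T * x) - L * T * x - M))"
  have [measurable]: "h \<in> borel_measurable borel" unfolding h_def by measurable
  have "AE x in lborel. T * x \<notin> N"
    by (rule AE_lborel_mult[OF T AE_not_in[OF N(1)]])
  then have "(\<integral>\<^sup>+x\<in>{0..1}. ennreal (max 0 (q (T * x) - L * T * x - M)) \<partial>lborel)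
      = (\<integral>\<^sup>+x\<in>{0..1}. ennreal (h x) \<partial>lborel)"
    by (intro nn_integral_cong_AE) (auto simp: h_def elim!: eventually_mono)
  also have "\<dots> \<le> (\<integral>\<^sup>+\<theta>\<in>{0..pi/2}. ennreal (h (cos \<theta>)) \<partial>lborel)"
    by (rule nn_integral_le_nn_integral_cos) (auto simp: h_def)
  also have "\<dots> \<le> (\<integral>\<^sup>+\<theta>\<in>{0..pi/2}. e2ennreal (Qo R (T * cos \<theta>)) \<partial>lborel)"
  proof (rule nn_integral_mono)
    fix \<theta> :: real
    have "ennreal (h (cos \<theta>)) \<le> e2ennreal (Qo R (T * cos \<theta>))" if \<theta>: "\<theta> \<in> {0..pi/2}"
    proof (cases "T * cos \<theta> \<in> N")
      case True
      then show ?thesis by (simp add: h_def)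
    next
      case False
      have "0 \<le> T * cos \<theta>" using \<theta> T by (auto simp: cos_ge_zero)
      with False N(2) have "q (T * cos \<theta>) = Q (T * cos \<theta>)" by auto
      then have "ennreal (h (cos \<theta>)) = e2ennreal (ereal (R (T * cos \<theta>) - M))"
        using False by (simp add: h_def R_def QL_def mult.assoc max_def ennreal_neg)
      also have "\<dots> \<le> e2ennreal (Qo R (T * cos \<theta>))"
        using Qm_le[OF \<theta>] unfolding M Qo_def ereal_minus(1)[symmetric]
        by (intro e2ennreal_mono ereal_minus_mono) auto
      finally show ?thesis .
    qed
    then show "ennreal (h (cos \<theta>)) * indicator {0..pi/2} \<theta> \<le> e2ennreal (Qo R (T * cos \<theta>)) * indicator {0..pi/2} \<theta>"
      by (auto simp: indicator_def)
  qed
  also have "\<dots> \<le> ennreal C"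
    using hyp unfolding R_def by (simp add: nn_integral_completion)
  finally have "(\<integral>\<^sup>+x\<in>{0..1}. ennreal (max 0 (q (T * x) - L * T * x - M)) \<partial>lborel) \<le> ennreal C" .
  with lower show thesis by (rule that)
qed

section \<open>Radial weights and orthogonal matrices\<close>

text \<open>
  A radial weight is invariant under orthogonal maps almost everywhere, because linear maps preserve
  null sets.
\<close>

lemma orthogonal_matrix_in_calG:
  fixes w :: "real^'d \<Rightarrow> real"
  assumes radial: "AE \<xi> in lebesgue. w \<xi> = f (norm \<xi>)" and A: "orthogonal_matrix A"
  shows "A \<in> calG w"
proof -
  have AT: "A ** transpose A = mat 1" "transpose A ** A = mat 1"
    using A by (auto simp: orthogonal_matrix_def)
  have norm: "norm (transpose A *v \<xi>) = norm \<xi>" for \<xi>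
    using A orthogonal_transformation_matrix[of "(*v) (transpose A)"]
    by (simp add: orthogonal_matrix_transpose orthogonal_transformation)
  obtain N where N: "N \<in> null_sets lebesgue" "{\<xi>. w \<xi> \<noteq> f (norm \<xi>)} \<subseteq> N"
    using radial unfolding eventually_ae_filter by auto
  have "negligible ((*v) A ` N)"
    using N(1)
    by (intro negligible_differentiable_image_negligible linear_imp_differentiable_on)
      (auto simp: negligible_iff_null_sets)
  then have "AE \<xi> in lebesgue. \<xi> \<notin> (*v) A ` N"
    by (intro AE_not_in) (simp add: negligible_iff_null_sets)
  then have "AE \<xi> in lebesgue. w (transpose A *v \<xi>) \<ge> 1 * w \<xi>"
    using radial
  proof eventually_elim
    case (elim \<xi>)
    have "\<xi> = A *v (transpose A *v \<xi>)"
      by (simp only: matrix_vector_mul_assoc AT matrix_vector_mul_lid)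
    with elim(1) have "transpose A *v \<xi> \<notin> N" by (metis image_eqI)
    with N(2) have "w (transpose A *v \<xi>) = f (norm (transpose A *v \<xi>))" by auto
    with elim(2) show ?case by (simp only: norm mult_1 order_refl)
  qed
  moreover have "invertible A" unfolding invertible_def using AT by blast
  ultimately show ?thesis unfolding calG_def by (intro CollectI conjI exI[of _ 1]) auto
qed

text \<open>
  The permutation matrix of the transposition of \<open>i\<close> and \<open>j\<close>, with row \<open>i\<close> multiplied by \<open>s\<close>.
\<close>

definition signed_swap :: "real \<Rightarrow> 'd \<Rightarrow> 'd \<Rightarrow> real^'d^'d" where
  "signed_swap s i j =
     (\<chi> a b. if b = (if a = i then j else if a = j then i else a) then (if a = i then s else 1) else 0)"

lemma orthogonal_signed_swap:
  assumes "s * s = 1"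
  shows "orthogonal_matrix (signed_swap s i j)"
proof -
  define t where "t = (\<lambda>a. if a = i then j else if a = j then i else a)"
  define e where "e = (\<lambda>a. if a = i then s else 1)"
  have t: "t a = t b \<longleftrightarrow> a = b" for a b unfolding t_def by auto
  have e: "e a * e a = 1" for a unfolding e_def using assms by auto
  have entry: "signed_swap s i j $ a $ c = (if c = t a then e a else 0)" for a c
    unfolding signed_swap_def t_def e_def by simp
  have "(signed_swap s i j ** transpose (signed_swap s i j)) $ a $ b = mat 1 $ a $ b" for a b
  proof -
    have "(signed_swap s i j ** transpose (signed_swap s i j)) $ a $ b
        = (\<Sum>c\<in>UNIV. signed_swap s i j $ a $ c * signed_swap s i j $ b $ c)"
      by (simp add: matrix_matrix_mult_def transpose_def)
    also have "\<dots> = (\<Sum>c\<in>UNIV. if c = t a then (if a = b then 1 else 0) else 0)"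
      by (intro sum.cong refl) (auto simp: entry t e)
    also have "\<dots> = mat 1 $ a $ b" by (simp add: mat_def)
    finally show ?thesis .
  qed
  then have "signed_swap s i j ** transpose (signed_swap s i j) = mat 1"
    by (intro vec_eq_iff[THEN iffD2] allI)
  then show ?thesis
    unfolding orthogonal_matrix_def using matrix_left_right_inverse by blast
qed

text \<open>
  Two swap matrices that differ only in the sign of row \<open>i\<close> have as their difference twice a
  matrix unit.
\<close>

lemma span_orthogonal_matrices: "span {A :: real^'d^'d. orthogonal_matrix A} = UNIV"
proof -
  define E :: "'d \<Rightarrow> 'd \<Rightarrow> real^'d^'d" where "E = (\<lambda>i j. \<chi> a b. if a = i \<and> b = j then 1 else 0)"
  have "E i j = (1/2) *\<^sub>R (signed_swap 1 i j - signed_swap (-1) i j)" for i j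
    by (auto simp: E_def signed_swap_def vec_eq_iff)
  moreover have "signed_swap s i j \<in> span {A. orthogonal_matrix A}" if "s \<in> {1, -1}" for s and i j :: 'd
    using that by (intro span_base CollectI orthogonal_signed_swap) auto
  ultimately have E: "E i j \<in> span {A. orthogonal_matrix A}" for i j
    by (simp only:) (intro span_scale span_diff, auto)
  have "M \<in> span {A. orthogonal_matrix A}" for M :: "real^'d^'d"
  proof -
    have entry: "(\<Sum>i\<in>UNIV. \<Sum>j\<in>UNIV. M $ i $ j *\<^sub>R E i j) $ a $ b = M $ a $ b" for a b
    proof -
      have "(\<Sum>i\<in>UNIV. \<Sum>j\<in>UNIV. M $ i $ j *\<^sub>R E i j) $ a $ b
          = (\<Sum>i\<in>UNIV. \<Sum>j\<in>UNIV. if j = b then if i = a then M $ i $ b else 0 else 0)"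
        unfolding sum_component vector_scaleR_component
        by (intro sum.cong refl) (simp add: E_def)
      also have "\<dots> = M $ a $ b" by simp
      finally show ?thesis .
    qed
    have "M = (\<Sum>i\<in>UNIV. \<Sum>j\<in>UNIV. M $ i $ j *\<^sub>R E i j)"
      by (intro vec_eq_iff[THEN iffD2] allI entry[symmetric])
    also have "\<dots> \<in> span {A. orthogonal_matrix A}"
      by (intro span_sum span_scale E)
    finally show ?thesis .
  qed
  then show ?thesis by auto
qed

section \<open>The weighted inequality in Euclidean space\<close>

lemma polys_measurable:
  assumes "P \<in> polys n"
  shows "P \<in> borel_measurable borel"
proof -
  obtain c where P: "P = (\<lambda>\<xi>. \<Sum>\<alpha> | (\<Sum>i\<in>UNIV. \<alpha> i) \<le> n. c \<alpha> * (\<Prod>i\<in>UNIV. complex_of_real (\<xi> $ i) ^ \<alpha> i))"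
    using assms unfolding polys_def by blast
  show ?thesis unfolding P
    by (intro borel_measurable_continuous_onI continuous_intros)
qed

lemma polys_on_line:
  assumes "P \<in> polys n"
  obtains p where "degree p \<le> n" "\<And>s. poly p (complex_of_real s) = P (s *\<^sub>R \<xi>)"
proof -
  obtain c where P: "P = (\<lambda>\<xi>. \<Sum>\<alpha> | (\<Sum>i\<in>UNIV. \<alpha> i) \<le> n. c \<alpha> * (\<Prod>i\<in>UNIV. complex_of_real (\<xi> $ i) ^ \<alpha> i))"
    using assms unfolding polys_def by blast
  define p where "p = (\<Sum>\<alpha> | (\<Sum>i\<in>UNIV. \<alpha> i) \<le> n.
    monom (c \<alpha> * (\<Prod>i\<in>UNIV. complex_of_real (\<xi> $ i) ^ \<alpha> i)) (\<Sum>i\<in>UNIV. \<alpha> i))"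
  have "degree p \<le> n" unfolding p_def
    by (intro degree_sum_le finite_multi_indices) (auto intro: order_trans[OF degree_monom_le])
  moreover have "poly p (complex_of_real s) = P (s *\<^sub>R \<xi>)" for s
    unfolding p_def P by (simp add: poly_sum poly_monom power_mult_distrib prod.distrib power_sum mult_ac)
  ultimately show thesis by (rule that)
qed

text \<open>
  The half-line inequality on each ray through the sphere of radius \<open>T\<close>. The radius is coupled to the
  degree such that, with \<open>T\<close> as the unit of length, the slopes \<open>K\<close> and \<open>3 K + 1\<close> become
  \<open>kap = K T\<close> and \<open>n - kap\<close>.
\<close>

lemma weighted_inequality:
  fixes P :: "real^'d \<Rightarrow> complex"
  assumes P: "P \<in> polys n" and [measurable]: "q \<in> borel_measurable borel"
    and "n \<ge> 1" "K \<ge> 0" "T > 0" "S \<ge> 0" and T: "(4 * K + 1) * T = real n"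
    and lower: "AE x in lborel. 1 \<le> x \<longrightarrow> M + (3 * K + 1) * T * x \<le> q (T * x)"
    and upper: "(\<integral>\<^sup>+x\<in>{0..1}. ennreal (max 0 (q (T * x) - (3 * K + 1) * T * x - M)) \<partial>lborel) \<le> ennreal S"
  shows "(\<integral>\<^sup>+\<xi>. ennreal ((cmod (P \<xi>))\<^sup>2 * exp (- q (norm \<xi>) + K * norm \<xi>)) \<partial>lborel)
    \<le> ennreal (halfline_const (CARD('d) - 1) * (256 * exp 81) ^ n * exp (4 * S)) *
      (\<integral>\<^sup>+\<xi>. ennreal ((cmod (P \<xi>))\<^sup>2 * exp (- q (norm \<xi>) - K * norm \<xi>)) \<partial>lborel)"
proof (rule nn_integral_le_if_ray_integral_le[OF _ _ \<open>T > 0\<close>])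
  note [measurable] = polys_measurable[OF P]
  show "(\<lambda>\<xi>. ennreal ((cmod (P \<xi>))\<^sup>2 * exp (- q (norm \<xi>) + K * norm \<xi>))) \<in> borel_measurable borel"
    "(\<lambda>\<xi>. ennreal ((cmod (P \<xi>))\<^sup>2 * exp (- q (norm \<xi>) - K * norm \<xi>))) \<in> borel_measurable borel"
    by measurable
  fix \<xi> :: "real^'d" assume \<xi>: "norm \<xi> = T"
  obtain p where p: "degree p \<le> n" "\<And>s. poly p (complex_of_real s) = P (s *\<^sub>R \<xi>)"
    using polys_on_line[OF P] by blast
  have nKT: "real n - K * T = (3 * K + 1) * T" using T by (simp add: algebra_simps)
  have ray: "ray_integral (\<lambda>\<xi>. ennreal ((cmod (P \<xi>))\<^sup>2 * exp (- q (norm \<xi>) + b * norm \<xi>))) \<xi>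
     = (\<integral>\<^sup>+x\<in>{0..}. ennreal (x ^ (CARD('d) - 1) * (cmod (poly p (of_real x)))\<^sup>2 * exp (- q (T * x) + (b * T) * x)) \<partial>lborel)" for b
    unfolding ray_integral_def p(2)
    by (intro nn_integral_cong) (auto simp: indicator_def \<xi> mult_ac simp flip: ennreal_mult)
  have "(\<integral>\<^sup>+x\<in>{0..}. ennreal (x ^ (CARD('d) - 1) * (cmod (poly p (of_real x)))\<^sup>2 * exp (- q (T * x) + (K * T) * x)) \<partial>lborel)
    \<le> ennreal (halfline_const (CARD('d) - 1) * (256 * exp 81) ^ n * exp (4 * S)) *
      (\<integral>\<^sup>+x\<in>{0..}. ennreal (x ^ (CARD('d) - 1) * (cmod (poly p (of_real x)))\<^sup>2 * exp (- q (T * x) - (K * T) * x)) \<partial>lborel)"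
  proof (rule half_line_inequality[OF \<open>n \<ge> 1\<close> p(1)])
    show "4 * (K * T) \<le> real n" using T \<open>T > 0\<close> by (simp add: algebra_simps)
    show "AE x in lborel. 1 \<le> x \<longrightarrow> M + (real n - K * T) * x \<le> q (T * x)"
      using lower unfolding nKT .
    show "(\<integral>\<^sup>+x\<in>{0..1}. ennreal (max 0 (q (T * x) - (real n - K * T) * x - M)) \<partial>lborel) \<le> ennreal S"
      using upper unfolding nKT .
  qed (use \<open>K \<ge> 0\<close> \<open>T > 0\<close> \<open>S \<ge> 0\<close> in auto)
  then show "ray_integral (\<lambda>\<xi>. ennreal ((cmod (P \<xi>))\<^sup>2 * exp (- q (norm \<xi>) + K * norm \<xi>))) \<xi>
    \<le> ennreal (halfline_const (CARD('d) - 1) * (256 * exp 81) ^ n * exp (4 * S)) *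
      ray_integral (\<lambda>\<xi>. ennreal ((cmod (P \<xi>))\<^sup>2 * exp (- q (norm \<xi>) - K * norm \<xi>))) \<xi>"
    using ray[of K] ray[of "- K"] by simp
qed

text \<open>
  Here \<open>T = n/(4 K + 1)\<close>. The allowance \<open>B + ln T\<close> for the oscillation contributes only the polynomial
  factor \<open>exp (4 B) T\<^sup>4\<close>, which the exponential factor swallows for large \<open>n\<close>; this removes the
  dependence of the bound on \<open>K\<close> and \<open>B\<close>.
\<close>

lemma eventually_weighted_inequality:
  fixes Q q :: "real \<Rightarrow> real" and K :: real
  assumes Q: "Q \<in> borel_measurable (lebesgue_on {0..})" and q: "q \<in> borel_measurable borel"
    and eq: "AE r in lborel. 0 \<le> r \<longrightarrow> Q r = q r"
    and osc: "\<forall>L>0. \<exists>B>0. \<forall>\<^sub>F t in at_top.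
      (\<integral>\<^sup>+\<theta>\<in>{0..pi/2}. e2ennreal (Qo (QL L Q) (t * cos \<theta>)) \<partial>lebesgue) < ennreal (B + ln t)"
    and K: "K \<ge> 0"
  shows "\<forall>\<^sub>F n in sequentially. \<forall>P\<in>polys n :: (real^'d \<Rightarrow> complex) set.
    (\<integral>\<^sup>+\<xi>. ennreal ((cmod (P \<xi>))\<^sup>2 * exp (- q (norm \<xi>) + K * norm \<xi>)) \<partial>lborel)
    \<le> ennreal (((256 * exp 81) ^ n)\<^sup>2) *
      (\<integral>\<^sup>+\<xi>. ennreal ((cmod (P \<xi>))\<^sup>2 * exp (- q (norm \<xi>) - K * norm \<xi>)) \<partial>lborel)"
proof -
  define c where "c = 4 * K + 1"
  have c: "c \<ge> 1" using K by (simp add: c_def)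
  obtain B where B: "\<forall>\<^sub>F t in at_top. (\<integral>\<^sup>+\<theta>\<in>{0..pi/2}. e2ennreal (Qo (QL (3 * K + 1) Q) (t * cos \<theta>)) \<partial>lebesgue)
      < ennreal (B + ln t)" "B > 0"
    using osc[rule_format, of "3 * K + 1"] K by auto
  have lim: "filterlim (\<lambda>n. real n / c) at_top sequentially"
    using c by real_asymp
  define h where "h = halfline_const (CARD('d) - 1)"
  have h: "h \<ge> 0" by (simp add: h_def halfline_const_def)
  have grow: "\<forall>\<^sub>F n in sequentially. h * exp (4 * B) * real n ^ 4 \<le> 2 ^ n"
    by real_asymp
  have "\<forall>\<^sub>F n in sequentially. real n / c \<ge> 1"
    using lim unfolding filterlim_at_top by blast
  with eventually_compose_filterlim[OF B(1) lim] grow show ?thesis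
    using eventually_ge_at_top[of 1]
  proof eventually_elim
    case (elim n)
    define T where "T = real n / c"
    have "c * T = real n" using c by (simp add: T_def)
    moreover have "T \<ge> 1" using elim(3) by (simp add: T_def)
    moreover have "1 * T \<le> c * T" using c \<open>T \<ge> 1\<close> by (intro mult_right_mono) auto
    ultimately have T: "T \<ge> 1" "T \<le> real n" "(4 * K + 1) * T = real n"
      by (auto simp: c_def)
    define S where "S = B + ln T"
    have S: "S \<ge> 0" using B(2) T(1) by (simp add: S_def)
    have "(\<integral>\<^sup>+\<theta>\<in>{0..pi/2}. e2ennreal (Qo (QL (3 * K + 1) Q) (T * cos \<theta>)) \<partial>lebesgue) < ennreal S"
      using elim(1) unfolding T_def S_def .
    then obtain M where M: "AE x in lborel. 1 \<le> x \<longrightarrow> M + (3 * K + 1) * T * x \<le> q (T * x)"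
      "(\<integral>\<^sup>+x\<in>{0..1}. ennreal (max 0 (q (T * x) - (3 * K + 1) * T * x - M)) \<partial>lborel) \<le> ennreal S"
      by (rule oscillation_bound[OF Q q eq, rotated]) (use T(1) in auto)
    have "exp (4 * S) = exp (4 * B) * T ^ 4"
      unfolding S_def using T(1) by (simp add: distrib_left exp_add exp_of_nat_mult[of 4, simplified])
    also have "\<dots> \<le> exp (4 * B) * real n ^ 4"
      using T by (intro mult_left_mono power_mono) auto
    finally have "h * exp (4 * S) \<le> h * (exp (4 * B) * real n ^ 4)"
      using h by (rule mult_left_mono)
    also have "\<dots> \<le> 2 ^ n" using elim(2) by (simp add: mult.assoc)
    also have "\<dots> \<le> (256 * exp 81) ^ n"
    proof (rule power_mono)
      have "1 \<le> exp (81::real)" by simp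
      then show "2 \<le> 256 * exp (81::real)" by linarith
    qed simp
    finally have "(256 * exp 81) ^ n * (h * exp (4 * S)) \<le> (256 * exp 81) ^ n * (256 * exp 81) ^ n"
      by (rule mult_left_mono) simp
    then have const: "h * (256 * exp 81) ^ n * exp (4 * S) \<le> ((256 * exp 81) ^ n)\<^sup>2"
      by (simp add: power2_eq_square mult_ac)
    show ?case
    proof
      fix P :: "real^'d \<Rightarrow> complex" assume P: "P \<in> polys n"
      let ?G = "\<integral>\<^sup>+\<xi>. ennreal ((cmod (P \<xi>))\<^sup>2 * exp (- q (norm \<xi>) - K * norm \<xi>)) \<partial>lborel"
      have "(\<integral>\<^sup>+\<xi>. ennreal ((cmod (P \<xi>))\<^sup>2 * exp (- q (norm \<xi>) + K * norm \<xi>)) \<partial>lborel)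
          \<le> ennreal (h * (256 * exp 81) ^ n * exp (4 * S)) * ?G"
        unfolding h_def using T elim K S by (intro weighted_inequality[OF P q _ _ _ _ _ M]) auto
      also have "\<dots> \<le> ennreal (((256 * exp 81) ^ n)\<^sup>2) * ?G"
        by (intro mult_right_mono ennreal_leI const) auto
      finally show "(\<integral>\<^sup>+\<xi>. ennreal ((cmod (P \<xi>))\<^sup>2 * exp (- q (norm \<xi>) + K * norm \<xi>)) \<partial>lborel)
          \<le> ennreal (((256 * exp 81) ^ n)\<^sup>2) * ?G" .
    qed
  qed
qed

section \<open>Weighted norms and their quotients\<close>

lemma ennreal_root_le:
  assumes "n \<ge> 1" "r \<ge> 0" "x \<le> ennreal (r ^ n) * y"
  shows "ennreal_root n x \<le> ennreal r * ennreal_root n y"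
proof (cases "y = \<infinity>")
  case True
  show ?thesis
  proof (cases "r = 0")
    case True
    with assms have "x = 0" by (simp add: power_0_left)
    then show ?thesis by (simp add: ennreal_root_def)
  next
    case False
    with \<open>y = \<infinity>\<close> \<open>r \<ge> 0\<close> show ?thesis by (simp add: ennreal_root_def ennreal_mult_top)
  qed
next
  case False
  then obtain b where b: "y = ennreal b" "b \<ge> 0" by (cases y) auto
  then have "x \<le> ennreal (r ^ n * b)" using assms by (simp add: ennreal_mult)
  moreover from this obtain a where a: "x = ennreal a" "a \<ge> 0"
    by (cases x) (auto simp: top_unique)
  ultimately have "a \<le> r ^ n * b" using assms b by (simp add: ennreal_le_iff)
  then have "root n a \<le> root n (r ^ n * b)" using \<open>n \<ge> 1\<close> by (intro real_root_le_mono) auto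
  also have "\<dots> = r * root n b" using assms by (simp add: real_root_mult real_root_power_cancel)
  finally show ?thesis using a b assms
    by (simp add: ennreal_root_def flip: ennreal_mult)
qed

text \<open>
  In the degenerate cases \<open>y = 0\<close> and \<open>y = \<infinity>\<close> the quotient is \<open>0\<close>: in the former
  also \<open>x\<close> vanishes.
\<close>

lemma ennreal_divide_le_if_le_mult:
  fixes x y :: ennreal
  assumes "x \<le> ennreal r * y"
  shows "x / y \<le> ennreal r"
proof (cases "y = 0 \<or> y = \<infinity>")
  case True
  with assms show ?thesis by (auto simp: divide_ennreal_def)
next
  case False
  have "x / y \<le> ennreal r * y / y" by (intro divide_right_mono_ennreal assms)
  also have "\<dots> = ennreal r" using False by (simp add: ennreal_mult_divide_eq)
  finally show ?thesis .
qed

lemma L2norm_radial: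
  fixes w :: "real^'d \<Rightarrow> real"
  assumes w: "w \<in> borel_measurable lebesgue" and radial: "AE \<xi> in lborel. w \<xi> = exp (- q (norm \<xi>))"
    and h: "h \<in> borel_measurable borel"
  shows "L2norm w h = ennreal_root 2 (\<integral>\<^sup>+\<xi>. ennreal ((cmod (h \<xi>))\<^sup>2 * exp (- q (norm \<xi>))) \<partial>lborel)"
proof -
  note [measurable] = w
  have [measurable]: "h \<in> borel_measurable lebesgue"
    using h by (intro measurable_completion) simp
  have "(\<integral>\<^sup>+\<xi>. ennreal ((cmod (h \<xi>))\<^sup>2) \<partial>density lebesgue (\<lambda>\<xi>. ennreal (w \<xi>)))
     = (\<integral>\<^sup>+\<xi>. ennreal (w \<xi>) * ennreal ((cmod (h \<xi>))\<^sup>2) \<partial>lebesgue)"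
    by (rule nn_integral_density) measurable
  also have "\<dots> = (\<integral>\<^sup>+\<xi>. ennreal (w \<xi>) * ennreal ((cmod (h \<xi>))\<^sup>2) \<partial>lborel)"
    by (rule nn_integral_completion)
  also have "\<dots> = (\<integral>\<^sup>+\<xi>. ennreal ((cmod (h \<xi>))\<^sup>2 * exp (- q (norm \<xi>))) \<partial>lborel)"
    by (rule nn_integral_cong_AE, use radial in eventually_elim) (simp add: mult.commute flip: ennreal_mult)
  finally show ?thesis unfolding L2norm_def by simp
qed

theorem theorem6:
  fixes w :: "real^'d \<Rightarrow> real"
  assumes L1: "integrable lebesgue w"
    and Linfty: "\<exists>C. AE \<xi> in lebesgue. \<bar>w \<xi>\<bar> \<le> C"
    and nonzero: "\<not> (AE \<xi> in lebesgue. w \<xi> = 0)"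
    and decay: "\<forall>a>0. \<exists>c>0. AE \<xi> in lebesgue. w \<xi> \<le> c * exp (- a * norm \<xi>)"
    and Q: "\<exists>Q :: real \<Rightarrow> real.
      Q \<in> borel_measurable (lebesgue_on {0..}) \<and>
      (AE \<xi> in lebesgue. w \<xi> = exp (- Q (norm \<xi>))) \<and>
      (\<forall>L>0. \<exists>B>0. \<forall>\<^sub>F t in at_top.
        (\<integral>\<^sup>+\<theta>\<in>{0..pi/2}. e2ennreal (Qo (QL L Q) (t * cos \<theta>)) \<partial>lebesgue) < ennreal (B + ln t))"
  shows "(\<exists>B>0. \<forall>y :: real^'d.
            limsup (\<lambda>n. E_minus n y w) < ennreal B \<and>
            limsup (\<lambda>n. E_plus n y w) < ennreal B) \<and>
         span (calG w) = (UNIV :: (real^'d^'d) set)"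
proof
  obtain Q where Q: "Q \<in> borel_measurable (lebesgue_on {0..})"
      "AE \<xi> in lebesgue. w \<xi> = exp (- Q (norm \<xi>))"
      "\<forall>L>0. \<exists>B>0. \<forall>\<^sub>F t in at_top.
        (\<integral>\<^sup>+\<theta>\<in>{0..pi/2}. e2ennreal (Qo (QL L Q) (t * cos \<theta>)) \<partial>lebesgue) < ennreal (B + ln t)"
    using assms(5) by blast
  have "{A. orthogonal_matrix A} \<subseteq> calG w"
    using orthogonal_matrix_in_calG[where f = "\<lambda>r. exp (- Q r)", OF Q(2)] by auto
  then show "span (calG w) = (UNIV :: (real^'d^'d) set)"
    using span_mono[of "{A. orthogonal_matrix A}" "calG w"] span_orthogonal_matrices by auto

  \<comment> \<open>A Borel version of \<open>Q\<close>, so that Fubini's theorem and substitution apply.\<close>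
  have "(\<lambda>r. if r \<in> {0..} then Q r else 0) \<in> borel_measurable lebesgue"
    using Q(1) by (intro borel_measurable_if_I) auto
  then obtain q where q: "q \<in> borel_measurable borel" "AE r in lborel. (if r \<in> {0..} then Q r else 0) = q r"
    using completion_ex_borel_measurable_real by force
  have Qq: "AE r in lborel. 0 \<le> r \<longrightarrow> Q r = q r"
    using q(2) by eventually_elim (auto split: if_splits)
  have wq: "AE \<xi> in lborel. w \<xi> = exp (- q (norm \<xi>))"
    using AE_norm[OF Qq, where 'a = "real^'d"] Q(2)[unfolded AE_completion_iff] by eventually_elim simp
  have w: "w \<in> borel_measurable lebesgue" using L1 by auto
  note L2 = L2norm_radial[OF w wq]

  define R :: real where "R = 256 * exp 81"
  have R: "R > 0" by (simp add: R_def)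
  have two_norm_nonneg: "0 \<le> 2 * norm y" for y :: "real^'d" by simp
  have main: "\<forall>\<^sub>F n in sequentially. E_minus n y w \<le> ennreal R \<and> E_plus n y w \<le> ennreal R" for y
    using eventually_weighted_inequality[OF Q(1) q(1) Qq Q(3) two_norm_nonneg[of y], where 'd = 'd]
      eventually_ge_at_top[of 1] unfolding R_def[symmetric]
  proof eventually_elim
    case (elim n)
    have y: "\<bar>2 * (y \<bullet> \<xi>)\<bar> \<le> 2 * norm y * norm \<xi>" for \<xi>
      using Cauchy_Schwarz_ineq2[of y \<xi>] by simp
    have mexp: "(cmod (mexp y P \<xi>))\<^sup>2 * exp (- q (norm \<xi>)) = (cmod (P \<xi>))\<^sup>2 * exp (- q (norm \<xi>) + 2 * (y \<bullet> \<xi>))" for P \<xi>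
      by (simp add: mexp_def norm_mult power_mult_distrib exp_diff exp_minus exp_double divide_inverse)
    have "L2norm w P \<le> ennreal (R ^ n) * L2norm w (mexp y P) \<and>
          L2norm w (mexp y P) \<le> ennreal (R ^ n) * L2norm w P" if P: "P \<in> polys n" for P
    proof -
      note [measurable] = polys_measurable[OF P]
      have [measurable]: "mexp y P \<in> borel_measurable borel" unfolding mexp_def[abs_def] by measurable
      let ?I = "\<lambda>g :: real^'d \<Rightarrow> real. \<integral>\<^sup>+\<xi>. ennreal ((cmod (P \<xi>))\<^sup>2 * exp (- q (norm \<xi>) + g \<xi>)) \<partial>lborel"
      have mono: "?I f \<le> ?I g" if "\<And>\<xi>. f \<xi> \<le> g \<xi>" for f g
        using that by (intro nn_integral_mono ennreal_leI mult_left_mono) auto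
      have main: "?I (\<lambda>\<xi>. 2 * norm y * norm \<xi>) \<le> ennreal ((R ^ n)\<^sup>2) * ?I (\<lambda>\<xi>. - (2 * norm y * norm \<xi>))"
        using elim(1) P by simp
      \<comment> \<open>All weights between the two extreme ones are comparable; both \<open>P\<close> and \<open>mexp y P\<close> lead to
        such weights, which gives both inequalities at once.\<close>
      have le: "ennreal_root 2 (?I f) \<le> ennreal (R ^ n) * ennreal_root 2 (?I g)"
        if f: "\<And>\<xi>. f \<xi> \<le> 2 * norm y * norm \<xi>" and g: "\<And>\<xi>. - (2 * norm y * norm \<xi>) \<le> g \<xi>" for f g
      proof (rule ennreal_root_le)
        have "?I f \<le> ?I (\<lambda>\<xi>. 2 * norm y * norm \<xi>)" using f by (rule mono)
        also note main
        also have "ennreal ((R ^ n)\<^sup>2) * ?I (\<lambda>\<xi>. - (2 * norm y * norm \<xi>)) \<le> ennreal ((R ^ n)\<^sup>2) * ?I g"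
          using g by (intro mult_left_mono mono) auto
        finally show "?I f \<le> ennreal ((R ^ n)\<^sup>2) * ?I g" .
      qed (use R in auto)
      have P0: "L2norm w P = ennreal_root 2 (?I (\<lambda>_. 0))"
        by (subst L2) auto
      have Py: "L2norm w (mexp y P) = ennreal_root 2 (?I (\<lambda>\<xi>. 2 * (y \<bullet> \<xi>)))"
        by (subst L2) (auto simp: mexp)
      have "2 * (y \<bullet> \<xi>) \<le> 2 * norm y * norm \<xi>" "- (2 * norm y * norm \<xi>) \<le> 2 * (y \<bullet> \<xi>)" for \<xi>
        using y[of \<xi>] by linarith+
      then show ?thesis unfolding P0 Py by (intro conjI le) auto
    qed
    then have "(SUP P\<in>polys n - {\<lambda>_. 0}. L2norm w P / L2norm w (mexp y P)) \<le> ennreal (R ^ n) * 1"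
      "(SUP P\<in>polys n - {\<lambda>_. 0}. L2norm w (mexp y P) / L2norm w P) \<le> ennreal (R ^ n) * 1"
      by (auto intro!: SUP_least ennreal_divide_le_if_le_mult)
    from this[THEN ennreal_root_le[rotated 2]] show ?case
      using elim(2) R unfolding E_minus_def E_plus_def by (auto simp: ennreal_root_def)
  qed
  show "\<exists>B>0. \<forall>y. limsup (\<lambda>n. E_minus n y w) < ennreal B \<and> limsup (\<lambda>n. E_plus n y w) < ennreal B"
  proof (intro exI[of _ "R + 1"] conjI allI)
    fix y
    have "limsup (\<lambda>n. E_minus n y w) \<le> ennreal R" "limsup (\<lambda>n. E_plus n y w) \<le> ennreal R"
      using main[of y] by (auto intro!: Limsup_bounded elim: eventually_mono)
    moreover have "ennreal R < ennreal (R + 1)" using R by (simp add: ennreal_less_iff)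
    ultimately show "limsup (\<lambda>n. E_minus n y w) < ennreal (R + 1)" "limsup (\<lambda>n. E_plus n y w) < ennreal (R + 1)"
      by (auto elim: le_less_trans)
  qed (use R in auto)
qed

end
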